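(* Let $m\ge 2$, let $L_m$ be the generalized Thue-Morse subshift over $A_m=\{0,1,\dots,m-1\}$, and let $T_{L_m}:[0,1)\to[0,1)$ be its associated (semi-conjugate) interval exchange transformation. Then $T_{L_m}$ is injective on $[0,1)$ except on exactly a set of $m(m-1)$ points, i.e. the set $\{x\in[0,1) \mid \exists x'\in[0,1),\ x'\ne x,\ T_{L_m}(x')=T_{L_m}(x)\}$ has exactly $m(m-1)$ elements, and this set can be partitioned into $m-1$ subsets of $m$ points each, such that all the points of a given subset have the same image under $T_{L_m}$.
   Context: Let $A_m=\{0,1,\dots,m-1\}$, identified with $\mathbb{Z}_m$ for arithmetic on letters, and ordered by $0<1<\dots<m-1$; infinite words in $A_m^{\mathbb N}$ are ordered lexicographically, and $A_m^{\mathbb N}$ has the product topology. The shift map is $\sigma(a_0a_1a_2\dots)=a_1a_2\dots$. The substitution $\varphi_m$ is defined by $\varphi_m(k)=k(k+1)$ (a two-letter word, addition mod $m$) for $k\in A_m$, extended to words by concatenation. The generalized Thue-Morse sequence is $t_m=\varphi_m^\infty(0)=\lim_n\varphi_m^n(0)$, and the Thue-Morse subshift is $L_m=\overline{\{\sigma^n(t_m)\mid n\in\mathbb N\}}$. It is minimal, aperiodic and uniquely ergodic; let $\mu$ be its unique $\sigma$-invariant Borel probability measure (non-atomic and positive on non-empty cylinders). Two words $w<w'$ of $L_m$ are consecutive if there is no $w''\in L_m$ with $w<w''<w'$. Let $[w,w']=\{w''\in L_m\mid w\le w''\le w'\}$ and let $w_{min}$ be the smallest word of $L_m$. Define $\phi_\mu:L_m\to[0,1]$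 by $\phi_\mu(w)=\mu([w_{min},w])$; it is non-decreasing, continuous, surjective, and each fibre $\phi_\mu^{-1}(x)$ is either a single word or a pair of consecutive words. Define $\phi_\mu^{inv}:[0,1]\to L_m$ by letting $\phi_\mu^{inv}(x)$ be the unique element of $\phi_\mu^{-1}(x)$ if this fibre is a singleton, and the greater of its two elements otherwise. The map $T_{L_m}:[0,1)\to[0,1)$ is $T_{L_m}(x)=\phi_\mu(\sigma(\phi_\mu^{inv}(x)))$. *)

theory Defs
  imports
    "HOL-Probability.Probability"
    "HOL-Library.Fun_Lexorder"
    "HOL-Library.Disjoint_Sets"
begin

text \<open>
  Infinite words are functions \<open>nat \<Rightarrow> nat\<close>, letters being natural numbers. The topology on
  \<open>nat \<Rightarrow> nat\<close> is the library's product topology (of the discrete topology on \<open>nat\<close>), of which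
  the words over the letters \<open>0, \<dots>, m - 1\<close> form a closed subspace. The strict lexicographic
  order on infinite words is the library's \<^const>\<open>less_fun\<close>.
\<close>

type_synonym word = "nat \<Rightarrow> nat"

definition lex_le :: "word \<Rightarrow> word \<Rightarrow> bool" where
  "lex_le u v \<longleftrightarrow> u = v \<or> less_fun u v"

definition shift :: "word \<Rightarrow> word" where
  "shift w = (\<lambda>n. w (Suc n))"

definition subst_letter :: "nat \<Rightarrow> nat \<Rightarrow> nat list" where
  "subst_letter m k = [k, (k + 1) mod m]"

definition subst :: "nat \<Rightarrow> nat list \<Rightarrow> nat list" where
  "subst m u = concat (map (subst_letter m) u)"

text \<open>The limit of a sequence of finite words: the infinite word each of whose letters is
  eventually the letter of the finite words at the same position.\<close>

definition word_limit :: "(nat \<Rightarrow> nat list) \<Rightarrow> word" where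
  "word_limit u = (THE w. \<forall>i. eventually (\<lambda>n. i < length (u n) \<and> u n ! i = w i) sequentially)"

definition thue_morse :: "nat \<Rightarrow> word" where
  "thue_morse m = word_limit (\<lambda>n. (subst m ^^ n) [0])"

definition thue_morse_subshift :: "nat \<Rightarrow> word set" where
  "thue_morse_subshift m = closure (range (\<lambda>n. (shift ^^ n) (thue_morse m)))"

definition invariant_prob :: "word set \<Rightarrow> word measure \<Rightarrow> bool" where
  "invariant_prob L \<mu> \<longleftrightarrow>
     prob_space \<mu> \<and> sets \<mu> = sets (restrict_space borel L) \<and>
     (\<forall>A\<in>sets \<mu>. emeasure \<mu> (shift -` A \<inter> L) = emeasure \<mu> A)"

definition word_interval :: "word set \<Rightarrow> word \<Rightarrow> word \<Rightarrow> word set" where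
  "word_interval L w w' = {v \<in> L. lex_le w v \<and> lex_le v w'}"

definition min_word :: "word set \<Rightarrow> word" where
  "min_word L = (THE w. w \<in> L \<and> (\<forall>v\<in>L. lex_le w v))"

definition phi :: "word set \<Rightarrow> word measure \<Rightarrow> word \<Rightarrow> real" where
  "phi L \<mu> w = measure \<mu> (word_interval L (min_word L) w)"

definition phi_fibre :: "word set \<Rightarrow> word measure \<Rightarrow> real \<Rightarrow> word set" where
  "phi_fibre L \<mu> x = {w \<in> L. phi L \<mu> w = x}"

definition phi_inv :: "word set \<Rightarrow> word measure \<Rightarrow> real \<Rightarrow> word" where
  "phi_inv L \<mu> x =
     (if is_singleton (phi_fibre L \<mu> x)
      then the_elem (phi_fibre L \<mu> x)
      else (THE w'. \<exists>w. phi_fibre L \<mu> x = {w, w'} \<and> less_fun w w'))"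

text \<open>Only the values of this map on \<open>[0,1)\<close> are meaningful.\<close>

definition iet :: "word set \<Rightarrow> word measure \<Rightarrow> real \<Rightarrow> real" where
  "iet L \<mu> x = phi L \<mu> (shift (phi_inv L \<mu> x))"

definition noninjectivity_points :: "('a \<Rightarrow> 'b) \<Rightarrow> 'a set \<Rightarrow> 'a set" where
  "noninjectivity_points f A = {x \<in> A. \<exists>x'\<in>A. x' \<noteq> x \<and> f x' = f x}"

end

(*
  Each point of [0,1) corresponds to a word of the subshift that is not maximal in any cylinder,
  and this set E of words is mapped into itself by the shift, because prepending a letter to a
  word that is maximal in a cylinder gives again such a word. As phi is injective on E, two points
  collide under the interval map iff the corresponding words of E have the same shift. By
  desubstitution a word with two left extensions must be a fixed point t^(c) of the substitution,
  and each t^(c) can be preceded by all m letters. All the extensions b t^(c) lie in E except those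
  with c = m - 2, since t^(m-2) is the largest word that begins with m - 2.
*)
theory Submission
  imports Defs
begin

subsection \<open>The digit sum and the Thue-Morse sequence\<close>

text \<open>Digit sums turn questions about occurrences of factors into arithmetic: the letter of
  t^(c) at n is c plus the binary digit sum of n, modulo m. An aligned block of length 2^N is the
  N-fold image of one letter and ends in that letter plus N, so N can be tuned to put any letter b
  in front of the image of c. The exception m - 2 arises because t^(c) continues after the N-fold
  image of c with the letter c + 1; a larger word can branch off there unless c + 1 is already the
  largest letter m - 1. The obstacle to desubstitution is that a word of L may begin in the middle
  of the image of a letter. That two readings of different parity cannot both hold follows from
  pairs of equal adjacent letters, which recur with bounded gaps and cannot be images. On the
  measure side, \<open>invariant_prob\<close> provides invariance only; positivity on cylinders and
  non-atomicity, on which all separation properties of \<open>\<phi>\<close> rest, are derived from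
  recurrence and aperiodicity.\<close>

fun bit_sum :: "nat \<Rightarrow> nat" where
  "bit_sum n = (if n = 0 then 0 else n mod 2 + bit_sum (n div 2))"

declare bit_sum.simps [simp del]

lemma bit_sum_0 [simp]: "bit_sum 0 = 0"
  by (simp add: bit_sum.simps)

lemma bit_sum_div_2: "bit_sum n = n mod 2 + bit_sum (n div 2)"
  by (cases "n = 0") (simp_all add: bit_sum.simps[of n])

lemma bit_sum_even [simp]: "bit_sum (2 * n) = bit_sum n"
  by (subst bit_sum_div_2) simp

lemma bit_sum_odd [simp]: "bit_sum (Suc (2 * n)) = Suc (bit_sum n)"
  by (subst bit_sum_div_2) simp

text \<open>The low \<open>N\<close> binary digits come from \<open>b\<close> and the higher ones
  from \<open>a\<close>, so the addition has no carry.\<close>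

lemma bit_sum_block: "b < 2 ^ N \<Longrightarrow> bit_sum (a * 2 ^ N + b) = bit_sum a + bit_sum b"
proof (induction N arbitrary: b)
  case (Suc N)
  have "(a * 2 ^ Suc N + b) div 2 = a * 2 ^ N + b div 2"
    by (simp add: algebra_simps)
  moreover have "(a * 2 ^ Suc N + b) mod 2 = b mod 2"
    by (metis mod_mult_self3 mult.assoc mult.commute power_Suc)
  moreover have "b div 2 < 2 ^ N"
    using Suc.prems by auto
  ultimately have "bit_sum (a * 2 ^ Suc N + b) = b mod 2 + bit_sum (a * 2 ^ N + b div 2)"
    by (metis bit_sum_div_2)
  also have "\<dots> = bit_sum a + (b mod 2 + bit_sum (b div 2))"
    using Suc.IH[OF \<open>b div 2 < 2 ^ N\<close>] by simp
  also have "\<dots> = bit_sum a + bit_sum b"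
    using bit_sum_div_2[of b] by simp
  finally show ?case .
qed simp

lemma bit_sum_1 [simp]: "bit_sum (Suc 0) = 1"
  using bit_sum_odd[of 0] by simp

lemma bit_sum_ones [simp]: "bit_sum (2 ^ n - 1) = n"
proof (induction n)
  case (Suc n)
  have "(1 :: nat) \<le> 2 ^ n" by simp
  then have "2 ^ Suc n - 1 = Suc (2 * (2 ^ n - 1 :: nat))"
    unfolding power_Suc by linarith
  then show ?case
    using Suc.IH by (simp only: bit_sum_odd)
qed simp

text \<open>The fixed point t^(c) in closed form. Passing from position n to 2n or 2n + 1 adds the
  last binary digit to the letter, just as the substitution does.\<close>

definition thue_word :: "nat \<Rightarrow> nat \<Rightarrow> word" where
  "thue_word m c n = (bit_sum n + c) mod m"

lemma subst_Cons: "subst m (k # u) = k # ((k + 1) mod m) # subst m u"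
  by (simp add: subst_def subst_letter_def)

lemma length_subst [simp]: "length (subst m u) = 2 * length u"
  by (induction u) (simp_all add: subst_Cons, simp add: subst_def)

lemma subst_nth:
  assumes "i < 2 * length u"
  shows "subst m u ! i = (if even i then u ! (i div 2) else (u ! (i div 2) + 1) mod m)"
  using assms
proof (induction u arbitrary: i)
  case (Cons k u)
  show ?case
  proof (cases "i < 2")
    case True
    then have "i = 0 \<or> i = 1" by auto
    then show ?thesis by (auto simp: subst_Cons)
  next
    case False
    then obtain j where "i = Suc (Suc j)"
      by (metis One_nat_def Suc_1 less_Suc0 less_Suc_eq not0_implies_Suc)
    then show ?thesis using Cons by (simp add: subst_Cons)
  qed
qed simp

lemma length_subst_funpow [simp]: "length ((subst m ^^ n) [0]) = 2 ^ n"
  by (induction n) simp_all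

lemma subst_funpow_nth:
  assumes "m > 0" "i < 2 ^ n"
  shows "(subst m ^^ n) [0] ! i = thue_word m 0 i"
  using assms(2)
proof (induction n arbitrary: i)
  case (Suc n)
  then have "i div 2 < 2 ^ n" by auto
  with Suc have *: "(subst m ^^ n) [0] ! (i div 2) = thue_word m 0 (i div 2)" by blast
  have "(subst m ^^ Suc n) [0] ! i =
      (if even i then thue_word m 0 (i div 2) else (thue_word m 0 (i div 2) + 1) mod m)"
    using Suc.prems by (simp add: subst_nth *)
  also have "\<dots> = thue_word m 0 i"
    by (cases "even i") (simp_all add: thue_word_def bit_sum_div_2[of i] mod_simps mod_2_eq_odd)
  finally show ?case .
qed (simp add: thue_word_def)

lemma thue_morse_eq:
  assumes "m > 0"
  shows "thue_morse m = thue_word m 0"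
proof -
  let ?P = "\<lambda>w. \<forall>i. eventually (\<lambda>n. i < length ((subst m ^^ n) [0]) \<and>
    (subst m ^^ n) [0] ! i = w i) sequentially"
  have ev: "\<forall>\<^sub>F n in sequentially. i < 2 ^ n" for i :: nat
    unfolding eventually_sequentially
    by (meson le_less_trans less_exp)
  have "?P (thue_word m 0)"
  proof
    fix i
    show "\<forall>\<^sub>F n in sequentially. i < length ((subst m ^^ n) [0]) \<and>
        (subst m ^^ n) [0] ! i = thue_word m 0 i"
      using ev[of i] by eventually_elim (simp add: subst_funpow_nth[OF assms])
  qed
  moreover have "w = thue_word m 0" if "?P w" for w
  proof
    fix i
    have "\<forall>\<^sub>F n in sequentially. w i = thue_word m 0 i"
      using spec[OF that, of i] by eventually_elim (metis subst_funpow_nth[OF assms] length_subst_funpow)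
    then show "w i = thue_word m 0 i" by simp
  qed
  ultimately show ?thesis
    unfolding thue_morse_def word_limit_def by (rule the_equality)
qed

subsection \<open>Infinite words\<close>

definition agree :: "nat \<Rightarrow> word \<Rightarrow> word \<Rightarrow> bool" where
  "agree n u v \<longleftrightarrow> (\<forall>i<n. u i = v i)"

lemma agreeD: "agree n u v \<Longrightarrow> i < n \<Longrightarrow> u i = v i"
  by (simp add: agree_def)

lemma agree_mono: "agree n u v \<Longrightarrow> k \<le> n \<Longrightarrow> agree k u v"
  by (simp add: agree_def)

lemma agree_refl [simp]: "agree n w w"
  by (simp add: agree_def)

lemma agree_0 [simp]: "agree 0 u v"
  by (simp add: agree_def)

lemma agree_sym: "agree n u v \<Longrightarrow> agree n v u"
  by (simp add: agree_def)

lemma agree_Suc: "agree (Suc n) u v \<longleftrightarrow> agree n u v \<and> u n = v n"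
  by (auto simp: agree_def less_Suc_eq)

lemma agree_trans: "agree n u v \<Longrightarrow> agree n v w \<Longrightarrow> agree n u w"
  by (auto simp: agree_def)

lemma agree_shift: "agree (Suc n) u v \<Longrightarrow> agree n (shift u) (shift v)"
  by (auto simp: agree_def shift_def)

lemma agree_less_funI: "agree k u v \<Longrightarrow> u k < v k \<Longrightarrow> less_fun u v"
  unfolding agree_def less_fun_def by blast

lemma less_fun_agreeE:
  assumes "less_fun u v"
  obtains k where "agree k u v" "u k < v k"
  using assms unfolding agree_def less_fun_def by blast

lemma less_fun_linear: "u = v \<or> less_fun u v \<or> less_fun v (u :: word)"
proof (cases "u = v")
  case False
  then obtain i where "u i \<noteq> v i" by blast
  define k where "k = (LEAST i. u i \<noteq> v i)"
  have "u k \<noteq> v k" unfolding k_def by (rule LeastI) fact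
  moreover have "agree k u v" unfolding agree_def k_def using not_less_Least by blast
  ultimately show ?thesis
    using agree_less_funI[of k u v] agree_less_funI[of k v u] agree_sym[of k u v]
    by (metis linorder_neqE_nat)
qed simp

lemma lex_le_iff: "lex_le u v \<longleftrightarrow> \<not> less_fun v u"
  using less_fun_linear[of u v] less_fun_asym[of u v] less_fun_irrefl[of u] by (auto simp: lex_le_def)

lemma lex_le_antisym: "lex_le u v \<Longrightarrow> lex_le v u \<Longrightarrow> u = v"
  using less_fun_asym[of u v] by (auto simp: lex_le_def)

lemma lex_le_less_trans: "lex_le u v \<Longrightarrow> less_fun v w \<Longrightarrow> less_fun u w"
  using less_fun_trans[of u v w] by (auto simp: lex_le_def)

text \<open>Cylinders are convex: a word that left the common prefix of \<open>u\<close> and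
  \<open>v\<close> early would fall below both or above both.\<close>

lemma agree_between:
  assumes "agree n u v" "less_fun u x" "lex_le x v"
  shows "agree n u x"
proof (cases "x = v")
  case False
  obtain k where k: "agree k u x" "u k < x k"
    using assms(2) by (rule less_fun_agreeE)
  obtain l where l: "agree l x v" "x l < v l"
    using assms(3) False unfolding lex_le_def by (auto elim: less_fun_agreeE)
  have "n \<le> k"
  proof (rule ccontr)
    assume "\<not> n \<le> k"
    then have "k < n" by simp
    then have uv: "u k = v k" "l \<le> k \<Longrightarrow> u l = v l"
      using assms(1) by (auto simp: agree_def)
    show False
    proof (cases "k < l")
      case True
      then show False using k(2) uv(1) agreeD[OF l(1) True] by simp
    next
      case False
      then have "u l \<le> x l"
        using k agreeD[OF k(1), of l] by (cases "l = k") auto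
      then show False using l(2) uv(2) False by simp
    qed
  qed
  then show ?thesis using k(1) agree_mono by blast
qed (use assms in simp)

section \<open>Extremal words of closed sets\<close>

text \<open>Greedy choice: fix the letters one at a time, each time passing to a word of
  \<open>A\<close> whose next letter is extremal among the words with the same prefix.
  \<open>R\<close> is left open so that one argument serves maxima and minima.\<close>

lemma lex_extremum:
  assumes "A \<noteq> {}"
    and closed: "\<And>w. (\<And>n. \<exists>v\<in>A. agree n w v) \<Longrightarrow> w \<in> A"
    and extremal: "\<And>n u. u \<in> A \<Longrightarrow>
      \<exists>v\<in>A. agree n u v \<and> (\<forall>v'\<in>A. agree n u v' \<longrightarrow> v' n = v n \<or> R (v' n) (v n))"
  shows "\<exists>w\<in>A. \<forall>v\<in>A. v = w \<or> (\<exists>k. agree k v w \<and> R (v k) (w k))"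
proof -
  \<comment> \<open>The invariant of the choice: any word of \<open>A\<close> that leaves
    \<open>u\<close> before position \<open>n\<close> loses to it at the first difference.\<close>
  let ?P = "\<lambda>n u. u \<in> A \<and> (\<forall>v\<in>A. agree n v u \<or> (\<exists>k<n. agree k v u \<and> R (v k) (u k)))"
  obtain f where f: "\<And>n. ?P n (f n)" "\<And>n. agree n (f n) (f (Suc n))"
  proof -
    have "\<exists>f. \<forall>n. ?P n (f n) \<and> agree n (f n) (f (Suc n))"
    proof (rule dependent_nat_choice)
      show "\<exists>u. ?P 0 u" using assms(1) by auto
    next
      fix u n
      assume u: "?P n u"
      then obtain w where w: "w \<in> A" "agree n u w"
        "\<And>v. v \<in> A \<Longrightarrow> agree n u v \<Longrightarrow> v n = w n \<or> R (v n) (w n)"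
        using extremal[of u n] by blast
      have "agree (Suc n) v w \<or> (\<exists>k<Suc n. agree k v w \<and> R (v k) (w k))" if v: "v \<in> A" for v
      proof (cases "agree n v u")
        case True
        then have "agree n v w" using w(2) by (rule agree_trans)
        moreover have "v n = w n \<or> R (v n) (w n)"
          using v agree_sym[OF True] by (rule w(3))
        ultimately show ?thesis
          using agree_Suc[of n v w] by blast
      next
        case False
        then obtain k where k: "k < n" "agree k v u" "R (v k) (u k)" using u v by blast
        have "agree k v w"
          using k(2) agree_mono[OF w(2) less_imp_le[OF k(1)]] by (rule agree_trans)
        moreover have "u k = w k" using w(2) k(1) by (rule agreeD)
        ultimately show ?thesis using k by (intro disjI2 exI[of _ k]) simp
      qed
      then show "\<exists>w. ?P (Suc n) w \<and> agree n u w" using w(1,2) by blast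
    qed
    then show ?thesis using that by blast
  qed
  have mono: "agree n (f n) (f (n + d))" for n d
  proof (induction d)
    case (Suc d)
    have "agree n (f (n + d)) (f (n + Suc d))"
      using f(2)[of "n + d"] by (auto intro: agree_mono)
    with Suc show ?case by (rule agree_trans)
  qed simp
  \<comment> \<open>Position \<open>i\<close> no longer changes from \<open>f (Suc i)\<close> on, so
    this diagonal word is the limit of the chosen words.\<close>
  define w where "w i = f (Suc i) i" for i
  have wf: "agree n w (f n)" for n
    unfolding agree_def
  proof (intro allI impI)
    fix i assume "i < n"
    then obtain d where "n = Suc i + d" using less_iff_Suc_add by auto
    then show "w i = f n i" using agreeD[OF mono[of "Suc i" d], of i] by (simp add: w_def)
  qed
  have "w \<in> A" by (rule closed) (use wf f(1) in blast)
  moreover have "v = w \<or> (\<exists>k. agree k v w \<and> R (v k) (w k))" if v: "v \<in> A" for v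
  proof (cases "v = w")
    case False
    then obtain i where i: "v i \<noteq> w i" by blast
    then have "\<not> agree (Suc i) v (f (Suc i))" by (auto simp: w_def dest: agreeD)
    then obtain k where k: "k < Suc i" "agree k v (f (Suc i))" "R (v k) (f (Suc i) k)"
      using f(1)[of "Suc i"] v by blast
    have "agree k v w"
      using k(2) agree_sym[OF agree_mono[OF wf less_imp_le[OF k(1)]]] by (rule agree_trans)
    moreover have "w k = f (Suc i) k" using wf k(1) by (rule agreeD)
    ultimately show ?thesis using k(3) by auto
  qed simp
  ultimately show ?thesis by blast
qed

text \<open>The bound \<open>b\<close> ensures that a largest next letter exists.\<close>

lemma lex_max_exists:
  assumes "A \<noteq> {}" "\<And>w. (\<And>n. \<exists>v\<in>A. agree n w v) \<Longrightarrow> w \<in> A"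
    and bound: "\<And>w i. w \<in> A \<Longrightarrow> w i < b"
  shows "\<exists>w\<in>A. \<forall>v\<in>A. lex_le v w"
proof -
  have "\<exists>w\<in>A. \<forall>v\<in>A. v = w \<or> (\<exists>k. agree k v w \<and> v k < w k)"
  proof (rule lex_extremum)
    fix n u assume "u \<in> A"
    then have "\<exists>v. (v \<in> A \<and> agree n u v) \<and> (\<forall>v'. v' \<in> A \<and> agree n u v' \<longrightarrow> v' n \<le> v n)"
      using bound by (intro ex_has_greatest_nat[of _ u _ b]) (auto intro: less_imp_le)
    then show "\<exists>v\<in>A. agree n u v \<and> (\<forall>v'\<in>A. agree n u v' \<longrightarrow> v' n = v n \<or> v' n < v n)"
      by (metis le_neq_implies_less)
  qed (use assms in auto)
  then obtain w where w: "w \<in> A" "\<And>v. v \<in> A \<Longrightarrow> v = w \<or> (\<exists>k. agree k v w \<and> v k < w k)"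
    by blast
  have "lex_le v w" if "v \<in> A" for v
    using w(2)[OF that] by (auto simp: lex_le_def intro: agree_less_funI)
  then show ?thesis using w(1) by blast
qed

lemma lex_min_exists:
  assumes "A \<noteq> {}" "\<And>w. (\<And>n. \<exists>v\<in>A. agree n w v) \<Longrightarrow> w \<in> A"
  shows "\<exists>w\<in>A. \<forall>v\<in>A. lex_le w v"
proof -
  have "\<exists>w\<in>A. \<forall>v\<in>A. v = w \<or> (\<exists>k. agree k v w \<and> v k > w k)"
  proof (rule lex_extremum)
    fix n u assume "u \<in> A"
    then have "\<exists>v. (v \<in> A \<and> agree n u v) \<and> (\<forall>v'. v' \<in> A \<and> agree n u v' \<longrightarrow> v n \<le> v' n)"
      by (intro ex_has_least_nat[of _ u]) auto
    then show "\<exists>v\<in>A. agree n u v \<and> (\<forall>v'\<in>A. agree n u v' \<longrightarrow> v' n = v n \<or> v' n > v n)"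
      by (metis le_neq_implies_less)
  qed (use assms in auto)
  then obtain w where w: "w \<in> A" "\<And>v. v \<in> A \<Longrightarrow> v = w \<or> (\<exists>k. agree k v w \<and> v k > w k)"
    by blast
  have "lex_le w v" if "v \<in> A" for v
    using w(2)[OF that] by (auto simp: lex_le_def intro: agree_less_funI agree_sym)
  then show ?thesis using w(1) by blast
qed

section \<open>The product topology in terms of common prefixes\<close>

lemma open_coordinate: "open {v :: word. P (v k)}"
proof -
  have "open ((\<lambda>v :: word. v k) -` {x. P x})"
    by (intro open_vimage Topological_Spaces.open_discrete continuous_on_product_coordinates)
  then show ?thesis by (simp add: vimage_def)
qed

lemma open_agree: "open {v. agree n w v}"
proof -
  have "{v. agree n w v} = (\<Inter>i\<in>{..<n}. {v. w i = v i})"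
    by (auto simp: agree_def)
  then show ?thesis
    by (simp only:) (intro open_INT finite_lessThan ballI open_coordinate)
qed

lemma open_agree_less: "open {v. agree k w v \<and> w k < v k}"
  by (intro open_Collect_conj open_agree open_coordinate)

text \<open>One direction holds because cylinders are open, the other because words sharing ever
  longer prefixes with \<open>w\<close> converge to it in every coordinate.\<close>

lemma mem_closure_iff: "w \<in> closure S \<longleftrightarrow> (\<forall>n. \<exists>v\<in>S. agree n w v)"
proof
  assume w: "w \<in> closure S"
  show "\<forall>n. \<exists>v\<in>S. agree n w v"
  proof
    fix n
    have "{v. agree n w v} \<inter> S \<noteq> {}"
      using w open_Int_closure_eq_empty[OF open_agree[of n w], of S] agree_refl[of n w] by blast
    then show "\<exists>v\<in>S. agree n w v" by blast
  qed
next
  assume "\<forall>n. \<exists>v\<in>S. agree n w v"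
  then obtain f where f: "\<And>n. f n \<in> S" "\<And>n. agree n w (f n)" by metis
  have "\<forall>\<^sub>F n in sequentially. f n i = w i" for i
    using eventually_gt_at_top[of i] by eventually_elim (metis f(2) agreeD)
  then have "limitin (product_topology (\<lambda>i. euclidean) UNIV) f w sequentially"
    by (simp add: limitin_componentwise tendsto_eventually)
  then have "f \<longlonglongrightarrow> w"
    by (simp add: euclidean_product_topology)
  then show "w \<in> closure S"
    using f(1) closure_subset by (intro Lim_in_closed_set[of "closure S" f] always_eventually) auto
qed

lemma shift_funpow: "(shift ^^ k) w i = w (k + i)"
  by (induction k arbitrary: i) (simp_all add: shift_def)

text \<open>Turns the orbit closure into a condition on factors, the form on which the substitution
  can act.\<close>

lemma mem_subshift_iff:
  assumes "m > 0"
  shows "w \<in> thue_morse_subshift m \<longleftrightarrow> (\<forall>n. \<exists>k. \<forall>i<n. w i = thue_word m 0 (k + i))"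
  unfolding thue_morse_subshift_def
  by (auto simp: mem_closure_iff agree_def shift_funpow thue_morse_eq[OF assms])

lemma closure_agree: "(\<And>n. \<exists>v\<in>closure S. agree n w v) \<Longrightarrow> w \<in> closure S"
  by (metis closure_closure mem_closure_iff)

section \<open>Letters and aligned blocks of the fixed points\<close>

lemma thue_word_0 [simp]: "c < m \<Longrightarrow> thue_word m c 0 = c"
  by (simp add: thue_word_def)

lemma thue_word_less: "m > 0 \<Longrightarrow> thue_word m c i < m"
  by (simp add: thue_word_def)

lemma thue_word_even [simp]: "thue_word m c (2 * n) = thue_word m c n"
  by (simp add: thue_word_def)

lemma thue_word_odd [simp]: "thue_word m c (Suc (2 * n)) = (thue_word m c n + 1) mod m"
  by (simp add: thue_word_def mod_simps)

text \<open>The aligned block with index \<open>k\<close> is the \<open>n\<close>-fold image of the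
  letter at \<open>k\<close>, hence a prefix of the fixed point of that letter.\<close>

lemma thue_word_block:
  "i < 2 ^ n \<Longrightarrow> thue_word m c (k * 2 ^ n + i) = thue_word m (thue_word m c k) i"
  using bit_sum_block[of i n k] by (simp add: thue_word_def mod_simps ac_simps)

lemma thue_word_block_end:
  "thue_word m c (k * 2 ^ n + (2 ^ n - 1)) = (thue_word m c k + n) mod m"
  using bit_sum_block[of "2 ^ n - 1" n k] unfolding bit_sum_ones thue_word_def
  by (simp add: mod_simps ac_simps)

lemma thue_word_block_start: "thue_word m c (k * 2 ^ n) = thue_word m c k"
  using bit_sum_block[of 0 n k] by (simp add: thue_word_def)

text \<open>The substitution acting on infinite words.\<close>

definition expand :: "nat \<Rightarrow> word \<Rightarrow> word" where
  "expand m u n = (u (n div 2) + n mod 2) mod m"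

lemma expand_even: "u n < m \<Longrightarrow> expand m u (2 * n) = u n"
  by (simp add: expand_def)

lemma expand_odd: "expand m u (Suc (2 * n)) = (u n + 1) mod m"
  by (simp add: expand_def)

lemma expand_thue_word: "expand m (\<lambda>i. thue_word m c (k + i)) i = thue_word m c (2 * k + i)"
proof (cases "even i")
  case True
  then obtain j where "i = 2 * j" by blast
  then show ?thesis
    using thue_word_even[of m c "k + j"] by (simp add: expand_def thue_word_def)
next
  case False
  then obtain j where "i = Suc (2 * j)" by (auto elim: oddE)
  then show ?thesis
    using thue_word_odd[of m c "k + j"] by (simp add: expand_def)
qed

lemma shift_shift_expand: "shift (shift (expand m u)) = expand m (shift u)"
  by (simp add: fun_eq_iff shift_def expand_def)

lemma expand_inj:
  assumes "expand m u = expand m v" "\<And>i. u i < m" "\<And>i. v i < m"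
  shows "u = v"
proof
  fix i
  show "u i = v i"
    using fun_cong[OF assms(1), of "2 * i"] by (simp add: expand_even assms(2,3))
qed

lemma shift_case_nat [simp]: "shift (case_nat b v) = v"
  by (simp add: shift_def)

lemma word_eqI: "u 0 = v 0 \<Longrightarrow> shift u = shift v \<Longrightarrow> u = v"
proof
  fix i
  assume "u 0 = v 0" "shift u = shift v"
  then show "u i = v i"
    by (cases i) (simp_all add: shift_def fun_eq_iff)
qed

subsection \<open>The generalized Thue-Morse subshift\<close>

locale generalized_thue_morse =
  fixes m :: nat
  assumes m: "m \<ge> 2"
begin

lemma m_pos: "m > 0"
  using m by simp

abbreviation "L \<equiv> thue_morse_subshift m"
abbreviation "t \<equiv> thue_word m 0"

lemma t_less: "t i < m"
  using m_pos by (rule thue_word_less)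

lemma mem_L_iff: "w \<in> L \<longleftrightarrow> (\<forall>n. \<exists>k. \<forall>i<n. w i = t (k + i))"
  by (rule mem_subshift_iff[OF m_pos])

lemma L_prefix:
  assumes "w \<in> L"
  shows "\<exists>k. \<forall>i<n. w i = t (k + i)"
  using iffD1[OF mem_L_iff assms] by (rule spec)

lemma L_I: "(\<And>n. \<exists>k. \<forall>i<n. w i = t (k + i)) \<Longrightarrow> w \<in> L"
  by (intro iffD2[OF mem_L_iff] allI)

lemma L_less:
  assumes "w \<in> L"
  shows "w i < m"
proof -
  obtain k where "\<forall>j<Suc i. w j = t (k + j)" using L_prefix[OF assms] by blast
  then show ?thesis using t_less by simp
qed

lemma L_shift: "w \<in> L \<Longrightarrow> shift w \<in> L"
proof -
  have "\<exists>k. \<forall>i<n. w (Suc i) = t (k + i)" if "w \<in> L" for n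
  proof -
    obtain k where "\<forall>i<Suc n. w i = t (k + i)" using L_prefix[OF \<open>w \<in> L\<close>] by blast
    then show ?thesis by (intro exI[of _ "Suc k"]) simp
  qed
  then show "w \<in> L \<Longrightarrow> shift w \<in> L"
    by (intro L_I) (simp add: shift_def)
qed

lemma t_shift_in_L: "(\<lambda>i. t (k + i)) \<in> L"
  by (intro L_I exI[of _ k]) simp

lemma L_agree: "(\<And>n. \<exists>v\<in>L. agree n w v) \<Longrightarrow> w \<in> L"
  unfolding thue_morse_subshift_def by (rule closure_agree)

section \<open>Desubstitution and words with two left extensions\<close>

lemma mod_Suc_neq: "a < m \<Longrightarrow> (a + 1) mod m \<noteq> a"
  using m by (cases "a + 1 = m") simp_all

lemma Suc_mod_inj: "a < m \<Longrightarrow> b < m \<Longrightarrow> (a + 1) mod m = (b + 1) mod m \<Longrightarrow> a = b"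
  by (cases "a + 1 = m"; cases "b + 1 = m") simp_all

text \<open>Either every prefix of \<open>w\<close> occurs in \<open>t\<close> at an even position,
  and \<open>w\<close> is an image; or some prefix occurs only at odd positions, hence so do all
  longer ones, and \<open>w\<close> begins with the second letter of an image.\<close>

lemma desubstitution:
  assumes "w \<in> L"
  shows "\<exists>u\<in>L. w = expand m u \<or> w = shift (expand m u)"
proof (cases "\<forall>n. \<exists>k. \<forall>i<n. w i = t (2 * k + i)")
  case True
  define u where "u = (\<lambda>i. w (2 * i))"
  have *: "\<exists>k. \<forall>i<n. u i = t (k + i) \<and> w i = t (2 * k + i)" for n
  proof -
    obtain k where k: "\<forall>i<2 * n. w i = t (2 * k + i)"
      using spec[OF True, of "2 * n"] by blast
    have "u i = t (k + i)" if "i < n" for i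
    proof -
      have "u i = t (2 * k + 2 * i)" using k that by (simp add: u_def)
      also have "2 * k + 2 * i = 2 * (k + i)" by simp
      finally show ?thesis unfolding thue_word_even .
    qed
    then show ?thesis using k by (intro exI[of _ k]) auto
  qed
  have "u \<in> L"
  proof (rule L_I)
    fix n
    show "\<exists>k. \<forall>i<n. u i = t (k + i)"
      using *[of n] by (rule ex_forward) simp
  qed
  moreover have "w i = expand m u i" for i
  proof -
    obtain k where k: "\<forall>j<Suc i. u j = t (k + j) \<and> w j = t (2 * k + j)"
      using *[of "Suc i"] by blast
    then have "w i = expand m (\<lambda>i. t (k + i)) i" by (simp add: expand_thue_word)
    also have "\<dots> = expand m u i" using k by (simp add: expand_def less_Suc_eq_le)
    finally show ?thesis .
  qed
  ultimately show ?thesis by blast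
next
  case False
  then obtain N where N: "\<And>k. \<exists>i<N. w i \<noteq> t (2 * k + i)" by blast
  \<comment> \<open>The first letter of \<open>w\<close> is the second letter of the image of
    \<open>u 0\<close>, so \<open>u 0\<close> is that letter minus 1, with \<open>m - 1\<close>
    standing for -1.\<close>
  define u where "u = case_nat ((w 0 + (m - 1)) mod m) (\<lambda>i. w (Suc (2 * i)))"
  have *: "\<exists>k. \<forall>i<n. u i = t (k + i) \<and> w i = t (2 * k + Suc i)" for n
  proof -
    \<comment> \<open>Length \<open>N\<close> forces an odd position; the further letters suffice to
      read off \<open>n\<close> letters of \<open>u\<close>.\<close>
    obtain l where l: "\<forall>i<N + 2 * n + 1. w i = t (l + i)" using L_prefix[OF assms] by blast
    have "odd l"
    proof
      assume "even l"
      then obtain k where "l = 2 * k" by blast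
      then show False using N[of k] l by auto
    qed
    then obtain k where k: "l = Suc (2 * k)" by (auto elim: oddE)
    have "u i = t (k + i)" if i: "i < n" for i
    proof (cases i)
      case 0
      have "w 0 = (t k + 1) mod m" using l k by simp
      then have "u 0 = (t k + 1 + (m - 1)) mod m" by (simp add: u_def mod_simps)
      also have "\<dots> = t k" using m t_less[of k] by simp
      finally show ?thesis using 0 by simp
    next
      case (Suc j)
      then have "u i = t (l + Suc (2 * j))" using l i by (simp add: u_def)
      also have "l + Suc (2 * j) = 2 * (k + i)" using k Suc by simp
      finally show ?thesis unfolding thue_word_even .
    qed
    then show ?thesis using k l by (intro exI[of _ k]) auto
  qed
  have "u \<in> L"
  proof (rule L_I)
    fix n
    show "\<exists>k. \<forall>i<n. u i = t (k + i)"
      using *[of n] by (rule ex_forward) simp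
  qed
  moreover have "w i = shift (expand m u) i" for i
  proof -
    obtain k where k: "\<forall>j<Suc (Suc i). u j = t (k + j) \<and> w j = t (2 * k + Suc j)"
      using *[of "Suc (Suc i)"] by blast
    then have "w i = expand m (\<lambda>i. t (k + i)) (Suc i)"
      unfolding expand_thue_word by simp
    also have "\<dots> = expand m u (Suc i)" using k by (simp add: expand_def less_Suc_eq_le)
    finally show ?thesis by (simp add: shift_def)
  qed
  ultimately show ?thesis by blast
qed

lemma L_expand_even: "u \<in> L \<Longrightarrow> expand m u (2 * n) = u n"
  by (rule expand_even) (rule L_less)

text \<open>The letters of \<open>t\<close> at 4j + 1 and 4j + 2 coincide, and any five consecutive
  letters contain such a pair.\<close>

lemma L_not_successive:
  assumes "w \<in> L"
  shows "\<exists>i. w (Suc i) \<noteq> (w i + 1) mod m"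
proof -
  obtain k where k: "\<forall>i<5. w i = t (k + i)" using L_prefix[OF assms] by blast
  obtain i j where ij: "i < 4" "k + i = Suc (4 * j)"
  proof -
    have "\<exists>i<4. \<exists>j. k + i = Suc (4 * j)" by presburger
    then show thesis using that by blast
  qed
  have "t (Suc (4 * j)) = (t j + 1) mod m"
    using thue_word_odd[of m 0 "2 * j"] by simp
  moreover have "t (Suc (Suc (4 * j))) = (t j + 1) mod m"
    using thue_word_even[of m 0 "Suc (2 * j)"] by simp
  moreover have "w i = t (k + i)" "w (Suc i) = t (k + Suc i)"
    using k ij(1) by auto
  ultimately have "w (Suc i) = w i"
    using ij(2) by simp
  then show ?thesis using mod_Suc_neq[OF L_less[OF assms, of i]] by metis
qed

text \<open>If \<open>w\<close> and its shift were both images, every two neighbouring letters of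
  \<open>w\<close> would form the image of a letter, and \<open>w\<close> would increase by 1 modulo
  \<open>m\<close> forever.\<close>

lemma left_special_not_both:
  assumes "w \<in> L" "u \<in> L" "v \<in> L" "w = expand m u" "shift w = expand m v"
  shows False
proof -
  have "w (Suc i) = (w i + 1) mod m" for i
  proof (cases "even i")
    case True
    then obtain j where j: "i = 2 * j" by blast
    show ?thesis unfolding j assms(4) expand_odd L_expand_even[OF assms(2)] ..
  next
    case False
    then obtain j where j: "i = Suc (2 * j)" by (auto elim: oddE)
    have "w (Suc i) = expand m v i" "w i = expand m v (2 * j)"
      using fun_cong[OF assms(5), of i] fun_cong[OF assms(5), of "2 * j"] j
      by (simp_all add: shift_def)
    then show ?thesis
      by (simp only: j expand_odd L_expand_even[OF assms(3)])
  qed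
  then show False using L_not_successive[OF assms(1)] by simp
qed

text \<open>Different parities are excluded by \<open>left_special_not_both\<close>. If both words
  are images, the common second letter determines the first. So both begin in the middle of an
  image, and their common tail comes from another pair of the same kind.\<close>

lemma left_special_desubstitution:
  assumes w: "w \<in> L" "w' \<in> L" "w \<noteq> w'" "shift w = shift w'"
  shows "\<exists>u\<in>L. \<exists>u'\<in>L. u \<noteq> u' \<and> shift u = shift u' \<and> shift w = expand m (shift u)"
proof -
  obtain u u' where u: "u \<in> L" "w = expand m u \<or> w = shift (expand m u)"
    and u': "u' \<in> L" "w' = expand m u' \<or> w' = shift (expand m u')"
    using desubstitution[OF w(1)] desubstitution[OF w(2)] by blast
  consider "w = expand m u" "w' = expand m u'" | "w = expand m u" "w' = shift (expand m u')"
    | "w = shift (expand m u)" "w' = expand m u'"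
    | "w = shift (expand m u)" "w' = shift (expand m u')"
    using u u' by blast
  then show ?thesis
  proof cases
    case 1
    have "w 1 = w' 1" using w(4) by (simp add: shift_def fun_eq_iff)
    then have "(u 0 + 1) mod m = (u' 0 + 1) mod m"
      unfolding 1 by (simp add: expand_def)
    then have "u 0 = u' 0"
      by (rule Suc_mod_inj[OF L_less[OF u(1)] L_less[OF u'(1)]])
    then have "w 0 = w' 0"
      unfolding 1 by (simp add: expand_def)
    then show ?thesis
      using word_eqI[OF _ w(4)] w(3) by blast
  next
    case 2
    have "shift w = expand m (shift u')"
      by (simp only: w(4) 2(2) shift_shift_expand)
    then show ?thesis
      using left_special_not_both[OF w(1) u(1) L_shift[OF u'(1)] 2(1)] by blast
  next
    case 3
    have "shift w' = expand m (shift u)"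
      by (simp only: w(4)[symmetric] 3(1) shift_shift_expand)
    then show ?thesis
      using left_special_not_both[OF w(2) u'(1) L_shift[OF u(1)] 3(2)] by blast
  next
    case 4
    have e: "shift w = expand m (shift u)" "shift w' = expand m (shift u')"
      by (simp_all only: 4 shift_shift_expand)
    have "shift u = shift u'"
      using w(4) L_less[OF L_shift[OF u(1)]] L_less[OF L_shift[OF u'(1)]]
      unfolding e by (rule expand_inj)
    moreover have "u \<noteq> u'" using 4 w(3) by blast
    ultimately show ?thesis
      using e(1) u(1) u'(1) by blast
  qed
qed

text \<open>Each desubstitution halves the prefix to be checked, yields again two words with a
  common shift, and preserves the letter at position 1.\<close>

lemma left_special:
  assumes "w \<in> L" "w' \<in> L" "w \<noteq> w'" "shift w = shift w'"
  shows "shift w = thue_word m (w 1)"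
proof
  fix i
  have "\<forall>i<2 ^ n. w (Suc i) = thue_word m (w 1) i" for n
    using assms
  proof (induction n arbitrary: w w')
    case 0
    have "w (Suc 0) = thue_word m (w 1) 0" using L_less[OF 0(1), of 1] by simp
    then show ?case by (metis less_one power_0)
  next
    case (Suc n)
    obtain u u' where u: "u \<in> L" "u' \<in> L" "u \<noteq> u'" "shift u = shift u'"
      "shift w = expand m (shift u)"
      using left_special_desubstitution[OF Suc.prems] by (elim bexE conjE) (rule that)
    have w: "w (Suc i) = (u (Suc (i div 2)) + i mod 2) mod m" for i
      using fun_cong[OF u(5), of i] by (simp add: shift_def expand_def)
    have w1: "w 1 = u 1"
      using w[of 0] L_less[OF u(1), of 1] by simp
    show ?case
    proof (intro allI impI)
      fix i :: nat
      assume "i < 2 ^ Suc n"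
      then have "i div 2 < 2 ^ n" by auto
      then have "u (Suc (i div 2)) = thue_word m (w 1) (i div 2)"
        unfolding w1 by (rule Suc.IH[OF u(1-4), rule_format])
      then have "w (Suc i) = (bit_sum (i div 2) + w 1 + i mod 2) mod m"
        by (simp only: w thue_word_def mod_add_left_eq)
      also have "bit_sum (i div 2) + w 1 + i mod 2 = bit_sum i + w 1"
        using bit_sum_div_2[of i] by linarith
      finally show "w (Suc i) = thue_word m (w 1) i"
        by (simp only: thue_word_def)
    qed
  qed
  from this[rule_format, OF less_exp, of i] show "shift w i = thue_word m (w 1) i"
    by (simp only: shift_def)
qed

section \<open>Left extensions of the fixed points\<close>

text \<open>Take \<open>k\<close> with binary expansion 1^r 0 1^e. Adding 1 turns 0 1^e into 1 0^e,
  so the digit sums at \<open>k\<close> and \<open>k + 1\<close> are r + e and r + 1;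
  \<open>r\<close> and \<open>e\<close> make these congruent to \<open>b\<close> and
  \<open>c\<close>.\<close>

lemma adjacent_letters:
  assumes "b < m" "c < m"
  shows "\<exists>k. t k = b \<and> t (Suc k) = c"
proof -
  define r where "r = c + (m - 1)"
  define e where "e = Suc (b + (m - c))"
  define j :: nat where "j = 2 ^ r - 1"
  define k :: nat where "k = j * 2 ^ Suc e + (2 ^ e - 1)"
  have "bit_sum k = bit_sum j + bit_sum (2 ^ e - 1)"
    unfolding k_def by (rule bit_sum_block) (simp add: less_imp_diff_less)
  then have "bit_sum k = r + e"
    by (simp only: j_def bit_sum_ones)
  moreover have "bit_sum (Suc k) = r + 1"
  proof -
    have "Suc k = j * 2 ^ Suc e + 2 ^ e"
      by (simp add: k_def)
    then have "bit_sum (Suc k) = bit_sum j + bit_sum (2 ^ e)"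
      using bit_sum_block[of "2 ^ e" "Suc e" j] by simp
    moreover have "bit_sum (2 ^ e) = 1"
      using bit_sum_block[of 0 e 1] by simp
    ultimately show ?thesis
      by (simp only: j_def bit_sum_ones)
  qed
  moreover have "r + e = b + 2 * m" "r + 1 = c + m"
    using assms m by (auto simp: r_def e_def)
  ultimately show ?thesis
    using assms by (intro exI[of _ k]) (simp add: thue_word_def)
qed

text \<open>Take neighbouring letters b - n and c in \<open>t\<close>. Their \<open>n\<close>-fold
  images meet in the letter \<open>b\<close> followed by the prefix of t^(c) of length 2^n.\<close>

lemma extension_in_L:
  assumes "b < m" "c < m"
  shows "case_nat b (thue_word m c) \<in> L"
proof (rule L_agree)
  fix n
  define b' where "b' = (b + n * (m - 1)) mod m"
  have "b' < m" using m by (simp add: b'_def)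
  then obtain k where k: "t k = b'" "t (Suc k) = c" using adjacent_letters assms by blast
  let ?K = "k * 2 ^ n + (2 ^ n - 1)"
  have "case_nat b (thue_word m c) i = t (?K + i)" if "i < n" for i
  proof (cases i)
    case 0
    have "n * (m - 1) + n = n * m" using m by (cases m) simp_all
    then have "b + n * (m - 1) + n = b + n * m" by simp
    then have "(b' + n) mod m = (b + n * m) mod m" by (metis b'_def mod_add_left_eq)
    then have "(b' + n) mod m = b" using assms by simp
    then show ?thesis using 0 k thue_word_block_end[of m 0 k n] by simp
  next
    case (Suc j)
    have "j < 2 ^ n" using that Suc less_exp[of n] by linarith
    moreover have "?K + i = Suc k * 2 ^ n + j" using Suc by simp
    ultimately show ?thesis using Suc k thue_word_block[of j n m 0 "Suc k"] by (simp only: nat.case)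
  qed
  then show "\<exists>v\<in>L. agree n (case_nat b (thue_word m c)) v"
    by (intro bexI[OF _ t_shift_in_L[of ?K]]) (simp add: agree_def)
qed

text \<open>After \<open>b\<close> and the \<open>N\<close>-fold image of \<open>c\<close>, t^(c)
  continues with c + 1 modulo \<open>m\<close>, while the competing word has m - 1 there. This is
  strictly larger because c is not m - 2.\<close>

lemma extension_not_max:
  assumes "b < m" "c < m" "c \<noteq> m - 2"
  shows "\<exists>v\<in>L. agree n (case_nat b (thue_word m c)) v \<and> less_fun (case_nat b (thue_word m c)) v"
proof -
  let ?w = "case_nat b (thue_word m c)"
  \<comment> \<open>\<open>N\<close> makes \<open>b\<close> the last letter of the \<open>N\<close>-th substitution image of the letter \<open>c - 1\<close>, and the
    word \<open>(c - 1) c (m - 1)\<close> occurs because its first two letters form the image of \<open>c - 1\<close>.\<close>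
  define N where "N = n * m + Suc (b + (m - c))"
  define a where "a = (c + (m - 1)) mod m"
  have "a < m" using m by (simp add: a_def)
  then obtain j where j: "t j = a" "t (Suc j) = m - 1"
    using adjacent_letters[of a "m - 1"] m by auto
  define K :: nat where "K = 2 * j * 2 ^ N + (2 ^ N - 1)"
  define v where "v = (\<lambda>i. t (K + i))"
  have v0: "v 0 = b"
  proof -
    have "v 0 = (a + N) mod m"
      using j thue_word_block_end[of m 0 "2 * j" N] by (simp add: v_def K_def)
    also have "\<dots> = (c + (m - 1) + N) mod m" by (simp add: a_def mod_simps)
    also have "c + (m - 1) + N = b + (n + 2) * m" using assms m by (simp add: N_def)
    also have "\<dots> mod m = b" using assms(1) unfolding mod_mult_self1 by simp
    finally show ?thesis .
  qed
  have "t (Suc (2 * j)) = (c + (m - 1) + 1) mod m"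
    using j by (simp add: a_def mod_simps)
  then have tj: "t (Suc (2 * j)) = c" using assms m by simp
  have vS: "v (Suc i) = thue_word m c i" if "i < 2 ^ N" for i
  proof -
    have "K + Suc i = Suc (2 * j) * 2 ^ N + i" by (simp add: K_def)
    then show ?thesis using thue_word_block[OF that, of m 0 "Suc (2 * j)"] tj by (simp only: v_def)
  qed
  have "K + Suc (2 ^ N) = (2 * Suc j) * 2 ^ N" by (simp add: K_def)
  then have "v (Suc (2 ^ N)) = m - 1"
    using thue_word_block_start[of m 0 "2 * Suc j" N] j by (simp add: v_def del: mult_Suc_right)
  moreover have "?w (Suc (2 ^ N)) = (c + 1) mod m"
    using thue_word_block_start[of m c 1 N] by (simp add: thue_word_def)
  moreover have "(c + 1) mod m < m - 1"
    using assms m by (cases "c = m - 1") auto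
  ultimately have less: "?w (Suc (2 ^ N)) < v (Suc (2 ^ N))" by simp
  have agr: "agree (Suc (2 ^ N)) ?w v"
    using v0 vS by (auto simp: agree_def split: nat.splits)
  \<comment> \<open>The summand \<open>n * m\<close> of \<open>N\<close> changes no residue; it only
    makes the common prefix at least \<open>n\<close> long.\<close>
  have "n * 1 \<le> n * m" using m by (intro mult_le_mono2) simp
  then have "n \<le> N" unfolding N_def by linarith
  also have "N < 2 ^ N" by (rule less_exp)
  finally have "agree n ?w v" using agr by (auto intro: agree_mono)
  moreover have "less_fun ?w v" using agr less by (rule agree_less_funI)
  ultimately show ?thesis using t_shift_in_L[of K] by (auto simp: v_def)
qed

text \<open>Descent on the first difference \<open>k\<close>: if \<open>w\<close> is an image, its
  desubstitution is a counterexample with first difference k / 2.\<close>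

lemma thue_word_max:
  assumes "w \<in> L" "w 0 = m - 2"
  shows "\<not> less_fun (thue_word m (m - 2)) w"
proof
  let ?t = "thue_word m (m - 2)"
  have t01: "?t 0 = m - 2" "?t 1 = m - 1" "?t 2 = m - 1"
    using m thue_word_odd[of m "m - 2" 0] thue_word_even[of m "m - 2" 1] by auto
  have "False" if "w \<in> L" "w 0 = m - 2" "agree k ?t w" "?t k < w k" for k w
    using that
  proof (induction k arbitrary: w rule: less_induct)
    case (less k)
    have k0: "k \<noteq> 0" using less.prems t01 by (metis less_irrefl)
    obtain u where u: "u \<in> L" "w = expand m u \<or> w = shift (expand m u)"
      using desubstitution less.prems by blast
    then consider "w = expand m u" | "w = shift (expand m u)" by blast
    then show False
    proof cases
      case 1
      have we: "w (2 * i) = u i" "w (Suc (2 * i)) = (u i + 1) mod m" for i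
        by (simp_all only: 1 L_expand_even[OF u(1)] expand_odd)
      \<comment> \<open>A letter at an odd position is determined by its predecessor, where both
        words still agree.\<close>
      have "even k"
      proof (rule ccontr)
        assume "odd k"
        then obtain j where j: "k = Suc (2 * j)" by (auto elim: oddE)
        then have "?t (2 * j) = w (2 * j)" using less.prems(3) by (auto dest: agreeD)
        then have "?t j = u j" by (simp add: we)
        then show False using less.prems(4) j by (simp add: we)
      qed
      then obtain j where j: "k = 2 * j" by blast
      have "j < k" using j k0 by simp
      moreover have "u 0 = m - 2" using we[of 0] less.prems by simp
      moreover have "agree j ?t u"
        unfolding agree_def
      proof (intro allI impI)
        fix i assume "i < j"
        then have "?t (2 * i) = w (2 * i)" using less.prems(3) j by (intro agreeD[of k]) auto
        then show "?t i = u i" unfolding thue_word_even we .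
      qed
      moreover have "?t j < u j" using less.prems(4) j we(1)[of j] by simp
      ultimately show False using less.IH u(1) by blast
    next
      case 2
      \<comment> \<open>Here \<open>w 1\<close> and \<open>w 2\<close> form the image of a letter,
        hence differ, whereas t^(m-2) has the largest letter m - 1 at both places; a larger
        \<open>w\<close> would have to match it there.\<close>
      have "w 1 = u 1" "w 2 = (u 1 + 1) mod m"
        using 2 L_less[OF u(1), of 1] by (auto simp: shift_def expand_def)
      then have w2: "w 2 = (w 1 + 1) mod m" by simp
      have "w 1 \<le> m - 1" "w 2 \<le> m - 1"
        using L_less[OF less.prems(1), of 1] L_less[OF less.prems(1), of 2] by auto
      then have "k \<noteq> 1" "k \<noteq> 2" using less.prems(4) t01 by auto
      then have "2 < k" using k0 by linarith
      then have "w 1 = m - 1" "w 2 = m - 1"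
        using agreeD[OF less.prems(3), of 1] agreeD[OF less.prems(3), of 2] t01 by auto
      then show False using w2 m by simp
    qed
  qed
  moreover assume "less_fun ?t w"
  ultimately show False
    using assms by (auto elim!: less_funE simp: agree_def)
qed

section \<open>Minimality and aperiodicity\<close>

text \<open>The letter 0 occurs in the \<open>m\<close>-fold image of every letter. So the
  \<open>N\<close>-fold image of 0, a prefix of \<open>t\<close> containing the wanted factor,
  occurs in every aligned block of length \<open>R\<close>. A search from \<open>k\<close> may have
  to wait for the next such block, hence the bound 2R.\<close>

lemma t_recurrent: "\<exists>K. \<forall>k. \<exists>i<K. \<forall>j<n. t (k + i + j) = t (p + j)"
proof -
  define N where "N = p + n"
  define R :: nat where "R = 2 ^ m * 2 ^ N"
  have R: "R > 0" by (simp add: R_def)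
  have "\<exists>i<R + R. \<forall>j<n. t (k + i + j) = t (p + j)" for k
  proof -
    define q where "q = Suc (k div R)"
    \<comment> \<open>Position 2^r - 1 of the \<open>m\<close>-fold image of \<open>t q\<close>
      carries the letter t q + r modulo \<open>m\<close>, which this \<open>r\<close> makes
      0.\<close>
    define r where "r = (m - t q) mod m"
    define l :: nat where "l = 2 ^ r - 1"
    have "r < m" using m by (simp add: r_def)
    have "t q + r = m \<or> t q + r = 0"
      using t_less[of q] m by (cases "t q = 0") (auto simp: r_def)
    then have tqr: "(t q + r) mod m = 0" by auto
    define a where "a = q * 2 ^ m + l"
    have "k < q * R" "q * R \<le> k + R"
      using dividend_less_div_times[OF R, of k] div_times_less_eq_dividend[of k R] by (auto simp: q_def)
    have l: "Suc l \<le> 2 ^ m"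
      using \<open>r < m\<close> power_increasing[of r m "2::nat"] by (simp add: l_def)
    have "2 ^ r \<le> (2 ^ m :: nat)" using \<open>r < m\<close> by (simp add: power_increasing)
    then have ta: "t a = 0"
      using tqr bit_sum_block[of l m q] l bit_sum_ones[of r, folded l_def]
      by (simp add: a_def thue_word_def mod_simps add.commute)
    have pN: "p + j < 2 ^ N" if "j < n" for j
      using that less_exp[of N] unfolding N_def by linarith
    define i where "i = a * 2 ^ N + p - k"
    have "Suc l * 2 ^ N \<le> R" using l unfolding R_def by (rule mult_le_mono1)
    moreover have "p < 2 ^ N" using less_exp[of N] unfolding N_def by linarith
    moreover have "a * 2 ^ N = q * R + l * 2 ^ N" by (simp add: a_def R_def algebra_simps)
    ultimately have "k + i = a * 2 ^ N + p" "i < R + R"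
      using \<open>k < q * R\<close> \<open>q * R \<le> k + R\<close> by (auto simp: i_def)
    moreover have "t (a * 2 ^ N + p + j) = t (p + j)" if "j < n" for j
      using thue_word_block[OF pN[OF that], of m 0 a] ta by (simp add: add.assoc)
    ultimately show ?thesis by metis
  qed
  then show ?thesis by blast
qed

lemma L_recurrent:
  assumes "w \<in> L"
  shows "\<exists>K. \<forall>v\<in>L. \<exists>i<K. agree n w ((shift ^^ i) v)"
proof -
  obtain p where p: "\<forall>j<n. w j = t (p + j)" using L_prefix[OF assms] by blast
  obtain K where K: "\<And>k. \<exists>i<K. \<forall>j<n. t (k + i + j) = t (p + j)" using t_recurrent by blast
  have "\<exists>i<K. agree n w ((shift ^^ i) v)" if v: "v \<in> L" for v
  proof -
    obtain k where k: "\<forall>i<K + n. v i = t (k + i)" using L_prefix[OF v] by blast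
    obtain i where i: "i < K" "\<forall>j<n. t (k + i + j) = t (p + j)" using K by blast
    have "w j = v (i + j)" if "j < n" for j
      using k i p that by (simp add: add.assoc)
    then show ?thesis using i(1) by (auto simp: agree_def shift_funpow)
  qed
  then show ?thesis by blast
qed

text \<open>By recurrence \<open>p\<close> would be a period of \<open>t\<close>. With b = 2^p - p,
  a step of \<open>p\<close> leads from b to 2^p and from 2^p + b to 2^(p+1). The letters at the two
  powers of 2 agree, yet those at b and 2^p + b differ by 1.\<close>

lemma L_aperiodic:
  assumes "w \<in> L" "p > 0"
  shows "(shift ^^ p) w \<noteq> w"
proof
  assume per: "(shift ^^ p) w = w"
  have t_per: "t (p + i) = t i" for i
  proof -
    have "t \<in> L" using t_shift_in_L[of 0] by simp
    then obtain k where k: "agree (Suc (p + i)) t ((shift ^^ k) w)"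
      using L_recurrent assms(1) by blast
    have "w (k + (p + i)) = w (k + i)"
      using fun_cong[OF per, of "k + i"] by (simp add: shift_funpow ac_simps)
    then show ?thesis
      using agreeD[OF k, of "p + i"] agreeD[OF k, of i] by (simp add: shift_funpow)
  qed
  define b where "b = 2 ^ p - p"
  have p: "p < 2 ^ p" by (rule less_exp)
  have "t b = t (1 * 2 ^ p)" using t_per[of b] p by (simp add: b_def)
  moreover have "p + (1 * 2 ^ p + b) = 1 * 2 ^ Suc p" using p unfolding b_def power_Suc by linarith
  then have "t (1 * 2 ^ p + b) = t (1 * 2 ^ Suc p)" using t_per by metis
  moreover have "t (1 * 2 ^ p + b) = (t b + 1) mod m"
    using bit_sum_block[of b p 1] p assms(2) by (simp add: b_def thue_word_def mod_simps)
  ultimately have "t 1 = (t 1 + 1) mod m"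
    unfolding thue_word_block_start by simp
  then show False using mod_Suc_neq[OF t_less[of 1]] by simp
qed

end

lemma continuous_on_shift: "continuous_on UNIV shift"
  unfolding shift_def by (intro continuous_on_coordinatewise_then_product continuous_on_product_coordinates)

lemma open_less_fun: "open {v :: word. less_fun w v}"
proof -
  have "{v. less_fun w v} = (\<Union>k. {v. agree k w v \<and> w k < v k})"
    by (auto elim: less_fun_agreeE intro: agree_less_funI)
  then show ?thesis by (simp add: open_UN open_agree_less)
qed

subsection \<open>Minimal aperiodic subshifts\<close>

text \<open>The interval side needs nothing about the substitution itself. \<open>recurrent\<close>
  expresses minimality, and \<open>b\<close> bounds the alphabet.\<close>

locale minimal_aperiodic_subshift =
  fixes L :: "word set" and b :: nat and \<mu> :: "word measure"
  assumes closed_L: "closed L"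
    and bounded: "w \<in> L \<Longrightarrow> w i < b"
    and shift_in: "w \<in> L \<Longrightarrow> shift w \<in> L"
    and recurrent: "w \<in> L \<Longrightarrow> v \<in> L \<Longrightarrow> \<exists>i. agree n w ((shift ^^ i) v)"
    and aperiodic: "w \<in> L \<Longrightarrow> p > 0 \<Longrightarrow> (shift ^^ p) w \<noteq> w"
    and invariant: "invariant_prob L \<mu>"
begin

sublocale prob_space \<mu>
  using invariant by (simp add: invariant_prob_def)

lemma sets_eq: "A \<in> sets \<mu> \<longleftrightarrow> A \<subseteq> L \<and> A \<in> sets borel"
proof -
  have "sets \<mu> = sets (restrict_space borel L)"
    using invariant by (simp add: invariant_prob_def)
  then show ?thesis
    using closed_L by (simp add: sets_restrict_space_iff borel_closed)
qed

lemma space_eq: "space \<mu> = L"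
proof -
  have "sets \<mu> = sets (restrict_space borel L)"
    using invariant by (simp add: invariant_prob_def)
  then show ?thesis
    by (simp add: sets_eq_imp_space_eq space_restrict_space)
qed

lemma L_closed_agree: "(\<And>n. \<exists>v\<in>L. agree n w v) \<Longrightarrow> w \<in> L"
  using mem_closure_iff[of w L] closed_L by simp

lemma sets_Int_open: "open U \<Longrightarrow> {v \<in> L. v \<in> U} \<in> sets \<mu>"
  unfolding sets_eq using closed_L by (auto simp: Collect_conj_eq borel_closed)

definition cylinder :: "nat \<Rightarrow> word \<Rightarrow> word set" where
  "cylinder n w = {v \<in> L. agree n w v}"

definition initial :: "word \<Rightarrow> word set" where
  "initial w = {v \<in> L. lex_le v w}"

lemma cylinder_sets [measurable]: "cylinder n w \<in> sets \<mu>"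
  using sets_Int_open[OF open_agree] by (simp add: cylinder_def)

lemma initial_eq: "initial w = L - {v \<in> L. less_fun w v}"
  by (auto simp: initial_def lex_le_iff)

lemma initial_sets [measurable]: "initial w \<in> sets \<mu>"
  unfolding initial_eq using sets_Int_open[OF open_less_fun, of w] sets.top[of \<mu>]
  by (simp add: space_eq sets.Diff)

lemma INT_cylinder:
  assumes "w \<in> L"
  shows "(\<Inter>n. cylinder n w) = {w}"
proof (intro equalityI subsetI)
  fix v assume "v \<in> (\<Inter>n. cylinder n w)"
  then have "agree (Suc i) w v" for i by (auto simp: cylinder_def)
  then have "w i = v i" for i using agreeD[of "Suc i" w v i] by simp
  then show "v \<in> {w}" by auto
qed (use assms in \<open>auto simp: cylinder_def\<close>)

lemma singleton_sets:
  assumes "w \<in> L"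
  shows "{w} \<in> sets \<mu>"
  unfolding INT_cylinder[OF assms, symmetric] by (rule sets.countable_INT) auto

lemma preimage_shift_sets: "A \<in> sets \<mu> \<Longrightarrow> shift -` A \<inter> L \<in> sets \<mu>"
  unfolding sets_eq
  using measurable_sets_borel[OF borel_measurable_continuous_onI[OF continuous_on_shift]] closed_L
  by (auto simp: borel_closed)

lemma preimage_shift_funpow:
  assumes "A \<in> sets \<mu>"
  shows "{v \<in> L. (shift ^^ n) v \<in> A} \<in> sets \<mu> \<and> measure \<mu> {v \<in> L. (shift ^^ n) v \<in> A} = measure \<mu> A"
proof (induction n)
  case 0
  have "{v \<in> L. v \<in> A} = A" using assms sets_eq by blast
  then show ?case using assms by simp
next
  case (Suc n)
  let ?B = "{v \<in> L. (shift ^^ n) v \<in> A}"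
  have eq: "{v \<in> L. (shift ^^ Suc n) v \<in> A} = shift -` ?B \<inter> L"
    using shift_in by (auto simp: funpow_swap1)
  have "emeasure \<mu> (shift -` ?B \<inter> L) = emeasure \<mu> ?B"
    using invariant conjunct1[OF Suc] unfolding invariant_prob_def by blast
  then have "measure \<mu> (shift -` ?B \<inter> L) = measure \<mu> ?B"
    by (simp only: measure_def)
  then show ?case
    unfolding eq using conjunct2[OF Suc] preimage_shift_sets[OF conjunct1[OF Suc]] by (simp only: simp_thms)
qed

section \<open>Non-atomicity and positivity on cylinders\<close>

text \<open>The preimages of the point under different powers of the shift are disjoint, since a
  common word would make \<open>w\<close> periodic, and have equal measure. Infinitely many fit into
  a finite measure only if it is 0.\<close>

lemma measure_singleton:
  assumes w: "w \<in> L"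
  shows "measure \<mu> {w} = 0"
proof -
  define A where "A n = {v \<in> L. (shift ^^ n) v \<in> {w}}" for n
  have A: "A n \<in> sets \<mu>" "measure \<mu> (A n) = measure \<mu> {w}" for n
    using preimage_shift_funpow[OF singleton_sets[OF w], of n] by (auto simp: A_def)
  have "A k \<inter> A n = {}" if "k < n" for k n
  proof -
    have "(shift ^^ (n - k)) w = w" if "(shift ^^ k) v = w" "(shift ^^ n) v = w" for v
    proof -
      have "(shift ^^ n) v = (shift ^^ (n - k)) ((shift ^^ k) v)"
        using \<open>k < n\<close> by (metis comp_apply funpow_add le_add_diff_inverse2 less_imp_le)
      then show ?thesis using that by simp
    qed
    then show ?thesis using aperiodic[OF w, of "n - k"] \<open>k < n\<close> by (auto simp: A_def)
  qed
  then have "disjoint_family A"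
    unfolding disjoint_family_on_def by (metis Int_commute nat_neq_iff)
  then have "(\<lambda>n. measure \<mu> (A n)) sums measure \<mu> (\<Union>n. A n)"
    using A(1) by (intro finite_measure_UNION) auto
  then have "summable (\<lambda>n :: nat. measure \<mu> {w})"
    unfolding A(2) by (rule sums_summable)
  then show ?thesis by (simp only: summable_const_iff)
qed

text \<open>By recurrence the preimages of the cylinder under all powers of the shift cover
  \<open>L\<close>, so they cannot all be null.\<close>

lemma measure_cylinder_pos:
  assumes w: "w \<in> L"
  shows "measure \<mu> (cylinder n w) > 0"
proof (rule ccontr)
  assume "\<not> measure \<mu> (cylinder n w) > 0"
  then have "measure \<mu> (cylinder n w) = 0"
    using measure_nonneg[of \<mu> "cylinder n w"] by linarith
  then have "{v \<in> L. (shift ^^ i) v \<in> cylinder n w} \<in> null_sets \<mu>" for i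
    using preimage_shift_funpow[OF cylinder_sets[of n w], of i] by (simp add: null_setsI emeasure_eq_measure)
  then have "(\<Union>i. {v \<in> L. (shift ^^ i) v \<in> cylinder n w}) \<in> null_sets \<mu>"
    by (rule null_sets_UN)
  moreover have "(\<Union>i. {v \<in> L. (shift ^^ i) v \<in> cylinder n w}) = L"
  proof -
    have "(shift ^^ i) v \<in> L" if "v \<in> L" for i v
      using that by (induction i) (auto intro: shift_in)
    then show ?thesis using recurrent[OF w] by (auto simp: cylinder_def)
  qed
  ultimately show False
    using emeasure_space_1 by (simp add: space_eq null_setsD1)
qed

lemma measure_cylinder_small:
  assumes w: "w \<in> L" and "e > 0"
  shows "\<exists>n. measure \<mu> (cylinder n w) < e"
proof -
  have "(\<lambda>n. measure \<mu> (cylinder n w)) \<longlonglongrightarrow> measure \<mu> (\<Inter>n. cylinder n w)"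
  proof (rule finite_Lim_measure_decseq)
    show "decseq (\<lambda>n. cylinder n w)"
      unfolding decseq_def cylinder_def using agree_mono by blast
  qed auto
  then have "(\<lambda>n. measure \<mu> (cylinder n w)) \<longlonglongrightarrow> 0"
    unfolding INT_cylinder[OF w] measure_singleton[OF w] .
  then have "\<forall>\<^sub>F n in sequentially. measure \<mu> (cylinder n w) < e"
    using assms(2) by (rule order_tendstoD(2))
  then show ?thesis by (auto simp: eventually_sequentially)
qed

lemma L_nonempty: "L \<noteq> {}"
  using not_empty by (simp add: space_eq)

lemma min_word_L: "min_word L \<in> L" "v \<in> L \<Longrightarrow> lex_le (min_word L) v"
proof -
  obtain w where w: "w \<in> L" "\<forall>v\<in>L. lex_le w v"
    using lex_min_exists[OF L_nonempty L_closed_agree] by blast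
  have "\<exists>!w. w \<in> L \<and> (\<forall>v\<in>L. lex_le w v)"
    by (rule ex1I[of _ w]) (use w in \<open>auto intro: lex_le_antisym\<close>)
  from theI'[OF this] show "min_word L \<in> L" "v \<in> L \<Longrightarrow> lex_le (min_word L) v"
    unfolding min_word_def by auto
qed

section \<open>Monotonicity and variation of \<open>\<phi>\<close>\<close>

abbreviation "\<phi> \<equiv> phi L \<mu>"

lemma phi_eq: "\<phi> w = measure \<mu> (initial w)"
proof -
  have "word_interval L (min_word L) w = initial w"
    unfolding word_interval_def initial_def using min_word_L(2) by blast
  then show ?thesis by (simp add: phi_def)
qed

lemma phi_le_1: "\<phi> w \<le> 1"
  by (simp add: phi_eq)

lemma initial_mono:
  assumes "less_fun u v"
  shows "initial u \<subseteq> initial v"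
  using lex_le_less_trans[OF _ assms] by (auto simp: initial_def lex_le_def)

lemma phi_mono: "less_fun u v \<Longrightarrow> \<phi> u \<le> \<phi> v"
  unfolding phi_eq by (intro finite_measure_mono initial_mono initial_sets)

lemma phi_min_word: "\<phi> (min_word L) = 0"
proof -
  have "initial (min_word L) = {min_word L}"
    using min_word_L lex_le_antisym[of _ "min_word L"] by (auto simp: initial_def lex_le_def[of "min_word L" "min_word L"])
  then show ?thesis by (simp add: phi_eq measure_singleton[OF min_word_L(1)])
qed

text \<open>A cylinder around \<open>x\<close> that is long enough to contain both first differences
  lies strictly between \<open>u\<close> and \<open>v\<close>, and it has positive measure.\<close>

lemma phi_strict:
  assumes x: "x \<in> L" and "less_fun u x" "less_fun x v"
  shows "\<phi> u < \<phi> v"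
proof -
  obtain k where k: "agree k u x" "u k < x k" using assms(2) by (rule less_fun_agreeE)
  obtain l where l: "agree l x v" "x l < v l" using assms(3) by (rule less_fun_agreeE)
  let ?C = "cylinder (Suc (max k l)) x"
  have C: "less_fun u y" "less_fun y v" if "y \<in> ?C" for y
  proof -
    have xy: "agree (Suc (max k l)) x y" using that by (simp add: cylinder_def)
    then have "agree k x y" "agree l y x" "x k = y k" "x l = y l"
      by (auto simp: agree_def)
    then show "less_fun u y" "less_fun y v"
      using k l agree_trans[of k u x y] agree_trans[of l y x v] by (auto intro: agree_less_funI)
  qed
  have "initial u \<inter> ?C = {}"
    using C(1) by (auto simp: initial_def lex_le_iff)
  then have "measure \<mu> (initial u \<union> ?C) = measure \<mu> (initial u) + measure \<mu> ?C"
    by (intro finite_measure_Union) auto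
  moreover have "initial u \<union> ?C \<subseteq> initial v"
    using C(2) initial_mono[OF less_fun_trans[OF assms(2,3)]]
    by (auto simp: cylinder_def initial_def lex_le_def[of _ v])
  then have "measure \<mu> (initial u \<union> ?C) \<le> measure \<mu> (initial v)"
    by (intro finite_measure_mono) auto
  ultimately show ?thesis
    using measure_cylinder_pos[OF x, of "Suc (max k l)"] by (simp add: phi_eq)
qed

lemma phi_le_cylinder:
  assumes "less_fun u v" "agree n u v" "agree n w u"
  shows "\<phi> v \<le> \<phi> u + measure \<mu> (cylinder n w)"
proof -
  have "initial v \<subseteq> initial u \<union> cylinder n w"
  proof
    fix x assume x: "x \<in> initial v"
    then have "x \<in> L" "lex_le x v" by (auto simp: initial_def)
    moreover have "agree n w x" if "less_fun u x"
      using assms(3) agree_between[OF assms(2) that \<open>lex_le x v\<close>] by (rule agree_trans)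
    ultimately show "x \<in> initial u \<union> cylinder n w"
      by (auto simp: initial_def cylinder_def lex_le_iff)
  qed
  then have "\<phi> v \<le> measure \<mu> (initial u \<union> cylinder n w)"
    unfolding phi_eq by (intro finite_measure_mono) auto
  also have "\<dots> \<le> \<phi> u + measure \<mu> (cylinder n w)"
    unfolding phi_eq by (intro measure_subadditive) (auto simp: emeasure_eq_measure)
  finally show ?thesis .
qed

text \<open>A word above \<open>w\<close> must leave \<open>w\<close> before position
  \<open>n\<close>, so the words of \<open>L\<close> above \<open>w\<close> form a closed set. Its
  least element, if any, is the successor of \<open>w\<close>, and passing to it adds only a null
  set.\<close>

lemma cylinder_max:
  assumes w: "w \<in> L" and max: "\<And>v. v \<in> L \<Longrightarrow> agree n w v \<Longrightarrow> \<not> less_fun w v"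
  shows "\<phi> w = 1 \<or> (\<exists>v\<in>L. less_fun w v \<and> \<phi> v = \<phi> w)"
proof (cases "{v \<in> L. less_fun w v} = {}")
  case True
  have "initial w = space \<mu>" unfolding initial_eq space_eq True by simp
  then show ?thesis by (simp add: phi_eq prob_space)
next
  case False
  have "u \<in> {v \<in> L. less_fun w v}" if u: "\<And>k. \<exists>v\<in>{v \<in> L. less_fun w v}. agree k u v" for u
  proof -
    obtain v where v: "v \<in> L" "less_fun w v" "agree n u v" using u[of n] by blast
    obtain k where k: "agree k w v" "w k < v k" using v(2) by (rule less_fun_agreeE)
    have "k < n"
      using max[OF v(1) agree_mono[OF k(1)]] v(2) not_less by blast
    then have "agree k v u" "v k = u k" using v(3) by (auto simp: agree_def)
    then have "less_fun w u"
      using agree_less_funI[OF agree_trans[OF k(1)]] k(2) by simp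
    moreover have "u \<in> L"
    proof (rule L_closed_agree)
      fix n show "\<exists>v\<in>L. agree n u v" using u[of n] by blast
    qed
    ultimately show ?thesis by blast
  qed
  then obtain v where v: "v \<in> L" "less_fun w v" "\<And>x. x \<in> L \<Longrightarrow> less_fun w x \<Longrightarrow> lex_le v x"
    using lex_min_exists[OF False] by blast
  have "initial v \<subseteq> initial w \<union> {v}"
  proof
    fix x assume "x \<in> initial v"
    then have x: "x \<in> L" "lex_le x v" by (auto simp: initial_def)
    then have "x = v" if "less_fun w x"
      using lex_le_antisym v(3)[OF x(1) that] by blast
    then show "x \<in> initial w \<union> {v}" using x(1) by (auto simp: initial_def lex_le_iff)
  qed
  then have "\<phi> v \<le> measure \<mu> (initial w \<union> {v})"
    unfolding phi_eq using singleton_sets[OF v(1)]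
    by (intro finite_measure_mono sets.Un initial_sets)
  also have "\<dots> \<le> \<phi> w + measure \<mu> {v}"
    unfolding phi_eq using singleton_sets[OF v(1)]
    by (intro measure_subadditive) (auto simp: emeasure_eq_measure)
  finally have "\<phi> v = \<phi> w"
    using measure_singleton[OF v(1)] phi_mono[OF v(2)] by simp
  then show ?thesis using v by blast
qed

text \<open>
  These are the words that are not maximal in any cylinder. Since \<open>\<mu>\<close> is non-atomic and positive on
  cylinders, they are exactly the words that \<^const>\<open>phi_inv\<close> picks for the points of \<open>[0,1)\<close>, and
  unlike general words they are separated by \<open>\<phi>\<close>.
\<close>

definition right_limits :: "word set" where
  "right_limits = {w \<in> L. \<forall>n. \<exists>v\<in>L. agree n w v \<and> less_fun w v}"

lemma right_limits_subset: "w \<in> right_limits \<Longrightarrow> w \<in> L"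
  by (simp add: right_limits_def)

lemma right_limits_phi_less:
  assumes "w \<in> right_limits" "v \<in> L" "less_fun w v"
  shows "\<phi> w < \<phi> v"
proof -
  obtain k where k: "agree k w v" "w k < v k" using assms(3) by (rule less_fun_agreeE)
  obtain x where x: "x \<in> L" "agree (Suc k) w x" "less_fun w x"
    using assms(1) by (auto simp: right_limits_def)
  have "agree k x v" "x k = w k"
    using k x(2) by (auto simp: agree_def)
  then have "less_fun x v" using k(2) by (auto intro: agree_less_funI)
  then show ?thesis using phi_strict x by blast
qed

lemma right_limits_phi_less_1:
  assumes "w \<in> right_limits"
  shows "\<phi> w < 1"
proof -
  obtain v where "v \<in> L" "less_fun w v" using assms by (auto simp: right_limits_def)
  then have "\<phi> w < \<phi> v" by (rule right_limits_phi_less[OF assms])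
  then show ?thesis using phi_le_1[of v] by simp
qed

text \<open>Contrapositive of \<open>cylinder_max\<close>: a word maximal in a cylinder has value 1
  or shares its value with a larger word.\<close>

lemma right_limitsI:
  assumes "w \<in> L" "\<phi> w < 1" "\<And>v. v \<in> L \<Longrightarrow> less_fun w v \<Longrightarrow> \<phi> v \<noteq> \<phi> w"
  shows "w \<in> right_limits"
proof (rule ccontr)
  assume "w \<notin> right_limits"
  then obtain n where "\<And>v. v \<in> L \<Longrightarrow> agree n w v \<Longrightarrow> \<not> less_fun w v"
    using assms(1) by (auto simp: right_limits_def)
  from cylinder_max[OF assms(1) this] show False
    using assms(2,3) by auto
qed

lemma phi_inj_right_limits: "inj_on \<phi> right_limits"
proof (rule inj_onI)
  fix u v assume "u \<in> right_limits" "v \<in> right_limits" "\<phi> u = \<phi> v"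
  then show "u = v"
    using less_fun_linear[of u v] right_limits_phi_less[of u v] right_limits_phi_less[of v u]
      right_limits_subset[of u] right_limits_subset[of v]
    by auto
qed

lemma shift_right_limits:
  assumes "w \<in> right_limits"
  shows "shift w \<in> right_limits"
proof -
  have "\<exists>v\<in>L. agree n (shift w) v \<and> less_fun (shift w) v" for n
  proof -
    obtain v where v: "v \<in> L" "agree (Suc n) w v" "less_fun w v"
      using assms by (auto simp: right_limits_def)
    obtain k where k: "agree k w v" "w k < v k" using v(3) by (rule less_fun_agreeE)
    have "k \<noteq> 0" using k(2) v(2) by (metis agreeD less_irrefl zero_less_Suc)
    then obtain j where "k = Suc j" using not0_implies_Suc by blast
    then have "agree j (shift w) (shift v)" "shift w j < shift v j"
      using k by (auto simp: agree_shift) (simp add: shift_def)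
    then have "less_fun (shift w) (shift v)" by (rule agree_less_funI)
    then show ?thesis using shift_in[OF v(1)] agree_shift[OF v(2)] by blast
  qed
  then show ?thesis
    using shift_in[OF right_limits_subset[OF assms]] by (simp add: right_limits_def)
qed

section \<open>Surjectivity of \<open>\<phi>\<close> and the selected inverse\<close>

text \<open>Let \<open>w\<close> be the greatest word in the closure of the words of value at most
  \<open>x\<close>. Nearby words of \<open>A\<close> bound its value from above and larger words
  bound it from below, up to the measure of a small cylinder around \<open>w\<close>.\<close>

lemma phi_surj:
  assumes "0 \<le> x" "x \<le> 1"
  shows "\<exists>w\<in>L. \<phi> w = x"
proof -
  define A where "A = {w \<in> L. \<phi> w \<le> x}"
  define A' where "A' = {w \<in> L. \<forall>n. \<exists>v\<in>A. agree n w v}"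
  have "min_word L \<in> A" using min_word_L(1) phi_min_word assms by (simp add: A_def)
  moreover have sub: "A \<subseteq> A'"
    unfolding A'_def A_def using agree_refl by blast
  ultimately have ne: "A' \<noteq> {}" by blast
  have closed: "w \<in> A'" if w: "\<And>n. \<exists>v\<in>A'. agree n w v" for w
  proof -
    have "\<exists>u\<in>A. agree n w u" for n
    proof -
      obtain v where v: "v \<in> A'" "agree n w v" using w[of n] by blast
      then obtain u where "u \<in> A" "agree n v u" by (auto simp: A'_def)
      then show ?thesis using agree_trans[OF v(2)] by blast
    qed
    moreover have "w \<in> L"
    proof (rule L_closed_agree)
      fix n show "\<exists>v\<in>L. agree n w v" using w[of n] by (auto simp: A'_def)
    qed
    ultimately show ?thesis by (simp add: A'_def)
  qed
  obtain w where w: "w \<in> A'" "\<And>v. v \<in> A' \<Longrightarrow> lex_le v w"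
  proof -
    have "\<exists>w\<in>A'. \<forall>v\<in>A'. lex_le v w"
      by (rule lex_max_exists[OF ne closed, of b]) (auto simp: A'_def bounded)
    then show ?thesis using that by blast
  qed
  have wL: "w \<in> L" using w(1) by (simp add: A'_def)
  have above: "x < \<phi> v" if "v \<in> L" "less_fun w v" for v
  proof (rule ccontr)
    assume "\<not> x < \<phi> v"
    then have "v \<in> A" using that(1) by (simp add: A_def)
    then have "lex_le v w" using sub w(2) by blast
    then show False using that(2) by (simp add: lex_le_iff)
  qed
  have upper: "\<phi> w \<le> x + measure \<mu> (cylinder n w)" for n
  proof -
    obtain v where v: "v \<in> A" "agree n w v" using w(1) by (auto simp: A'_def)
    have "lex_le v w" using sub v(1) w(2) by blast
    then have "\<phi> w \<le> \<phi> v + measure \<mu> (cylinder n w)"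
      using phi_le_cylinder[of v w n w] v(2) agree_sym[OF v(2)] by (auto simp: lex_le_def)
    then show ?thesis using v(1) by (simp add: A_def)
  qed
  have lower: "x \<le> \<phi> w + measure \<mu> (cylinder n w)" for n
  proof (cases "\<exists>v\<in>L. agree n w v \<and> less_fun w v")
    case True
    then obtain v where v: "v \<in> L" "agree n w v" "less_fun w v" by blast
    then have "\<phi> v \<le> \<phi> w + measure \<mu> (cylinder n w)" by (intro phi_le_cylinder) auto
    then show ?thesis using above[OF v(1,3)] by linarith
  next
    \<comment> \<open>Here \<open>w\<close> is maximal in the cylinder. Its value is 1, or that of a
      larger word, which exceeds \<open>x\<close>.\<close>
    case False
    then have "\<phi> w = 1 \<or> (\<exists>v\<in>L. less_fun w v \<and> \<phi> v = \<phi> w)"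
      using cylinder_max[OF wL] by blast
    then have "x \<le> \<phi> w" using above assms(2) by fastforce
    then show ?thesis using measure_nonneg[of \<mu> "cylinder n w"] by linarith
  qed
  have "\<phi> w = x"
  proof (rule ccontr)
    assume "\<phi> w \<noteq> x"
    then obtain n where "measure \<mu> (cylinder n w) < \<bar>\<phi> w - x\<bar>"
      using measure_cylinder_small[OF wL, of "\<bar>\<phi> w - x\<bar>"] by auto
    then show False using upper[of n] lower[of n] by linarith
  qed
  then show ?thesis using wL by blast
qed

lemma phi_inv_greatest:
  assumes "0 \<le> x" "x \<le> 1"
  shows "phi_inv L \<mu> x \<in> L" "\<phi> (phi_inv L \<mu> x) = x"
    and "\<And>v. v \<in> L \<Longrightarrow> less_fun (phi_inv L \<mu> x) v \<Longrightarrow> \<phi> v \<noteq> x"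
proof -
  let ?F = "phi_fibre L \<mu> x"
  \<comment> \<open>A fibre has at most two words: a middle one of three would separate the values
    of the outer two.\<close>
  have no3: "\<not> (less_fun u v \<and> less_fun v z)" if "u \<in> ?F" "v \<in> ?F" "z \<in> ?F" for u v z
    using phi_strict[of v u z] that by (auto simp: phi_fibre_def)
  obtain w where w: "w \<in> ?F"
    using phi_surj[OF assms] by (auto simp: phi_fibre_def)
  have "phi_inv L \<mu> x \<in> ?F \<and> (\<forall>v\<in>?F. lex_le v (phi_inv L \<mu> x))"
  proof (cases "is_singleton ?F")
    case True
    then obtain u where u: "?F = {u}" by (rule is_singletonE)
    then have "phi_inv L \<mu> x = u" by (simp add: phi_inv_def)
    then show ?thesis using u by (simp add: lex_le_def)
  next
    case False
    then have "?F \<noteq> {w}" by auto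
    then obtain w' where w': "w' \<in> ?F" "w' \<noteq> w" using w by blast
    then have "less_fun w w' \<or> less_fun w' w" using less_fun_linear[of w w'] by simp
    then obtain l g where lg: "l \<in> ?F" "g \<in> ?F" "less_fun l g"
      using w w'(1) that by (elim disjE)
    have "v = l \<or> v = g" if v: "v \<in> ?F" for v
      using no3[OF v lg(1,2)] no3[OF lg(1) v lg(2)] no3[OF lg(1,2) v] lg(3)
        less_fun_linear[of v l] less_fun_linear[of v g] by metis
    then have F: "?F = {l, g}" using lg(1,2) by blast
    have "phi_inv L \<mu> x = (THE w'. \<exists>w. ?F = {w, w'} \<and> less_fun w w')"
      using False by (simp only: phi_inv_def if_False)
    also have "\<dots> = g"
    proof (rule the_equality)
      show "\<exists>w. ?F = {w, g} \<and> less_fun w g"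
        by (intro exI[of _ l] conjI F lg(3))
    next
      fix w' assume "\<exists>w. ?F = {w, w'} \<and> less_fun w w'"
      then obtain w where ww: "{l, g} = {w, w'}" "less_fun w w'"
        unfolding F by (elim exE conjE) (rule that)
      then have "(w = l \<and> w' = g) \<or> (w = g \<and> w' = l)" by (simp only: doubleton_eq_iff) auto
      then show "w' = g" using ww(2) less_fun_asym[OF lg(3)] by blast
    qed
    finally show ?thesis unfolding F using lg(3) by (simp add: lex_le_def)
  qed
  then show "phi_inv L \<mu> x \<in> L" "\<phi> (phi_inv L \<mu> x) = x"
    and "\<And>v. v \<in> L \<Longrightarrow> less_fun (phi_inv L \<mu> x) v \<Longrightarrow> \<phi> v \<noteq> x"
    by (auto simp: phi_fibre_def lex_le_iff)
qed

lemma phi_inv_right_limits: "0 \<le> x \<Longrightarrow> x < 1 \<Longrightarrow> phi_inv L \<mu> x \<in> right_limits"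
  using phi_inv_greatest[of x] by (intro right_limitsI) auto

lemma phi_inv_phi:
  assumes "w \<in> right_limits"
  shows "phi_inv L \<mu> (\<phi> w) = w"
proof -
  have "0 \<le> \<phi> w" "\<phi> w < 1"
    using right_limits_phi_less_1[OF assms] by (auto simp: phi_eq)
  then show ?thesis
    using phi_inv_right_limits phi_inv_greatest(2) assms
    by (intro inj_onD[OF phi_inj_right_limits]) auto
qed

lemma iet_phi: "w \<in> right_limits \<Longrightarrow> iet L \<mu> (\<phi> w) = \<phi> (shift w)"
  by (simp add: iet_def phi_inv_phi)

lemma phi_image_right_limits: "\<phi> ` right_limits = {0..<1}"
proof
  show "\<phi> ` right_limits \<subseteq> {0..<1}"
    using right_limits_phi_less_1 by (auto simp: phi_eq)
  show "{0..<1} \<subseteq> \<phi> ` right_limits"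
  proof
    fix x :: real assume "x \<in> {0..<1}"
    then have "phi_inv L \<mu> x \<in> right_limits" "\<phi> (phi_inv L \<mu> x) = x"
      using phi_inv_right_limits phi_inv_greatest(2)[of x] by auto
    then show "x \<in> \<phi> ` right_limits" by force
  qed
qed

lemma noninjectivity_points_iet:
  "noninjectivity_points (iet L \<mu>) {0..<1} =
    \<phi> ` {w \<in> right_limits. \<exists>w'\<in>right_limits. w' \<noteq> w \<and> shift w' = shift w}"
proof -
  have iet_eq: "iet L \<mu> (\<phi> u) = iet L \<mu> (\<phi> v) \<longleftrightarrow> shift u = shift v"
    if "u \<in> right_limits" "v \<in> right_limits" for u v
    using that inj_on_eq_iff[OF phi_inj_right_limits shift_right_limits shift_right_limits, of u v]
    by (simp add: iet_phi)
  have phi_eq_iff: "\<phi> u = \<phi> v \<longleftrightarrow> u = v" if "u \<in> right_limits" "v \<in> right_limits" for u v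
    using phi_inj_right_limits that by (rule inj_on_eq_iff)
  show ?thesis
    unfolding noninjectivity_points_def phi_image_right_limits[symmetric]
  proof (intro equalityI subsetI)
    fix x assume "x \<in> {x \<in> \<phi> ` right_limits. \<exists>x'\<in>\<phi> ` right_limits. x' \<noteq> x \<and> iet L \<mu> x' = iet L \<mu> x}"
    then obtain u v where u: "u \<in> right_limits" "x = \<phi> u" and v: "v \<in> right_limits" "\<phi> v \<noteq> \<phi> u"
      "iet L \<mu> (\<phi> v) = iet L \<mu> (\<phi> u)" by blast
    then have "v \<noteq> u" "shift v = shift u" using iet_eq[OF v(1) u(1)] by auto
    then show "x \<in> \<phi> ` {w \<in> right_limits. \<exists>w'\<in>right_limits. w' \<noteq> w \<and> shift w' = shift w}"
      using u v(1) by blast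
  next
    fix x assume "x \<in> \<phi> ` {w \<in> right_limits. \<exists>w'\<in>right_limits. w' \<noteq> w \<and> shift w' = shift w}"
    then obtain u v where u: "u \<in> right_limits" "x = \<phi> u" and v: "v \<in> right_limits" "v \<noteq> u"
      "shift v = shift u" by blast
    then have "\<phi> v \<noteq> \<phi> u" "iet L \<mu> (\<phi> v) = iet L \<mu> (\<phi> u)"
      using iet_eq[OF v(1) u(1)] phi_eq_iff[OF v(1) u(1)] by auto
    then show "x \<in> {x \<in> \<phi> ` right_limits. \<exists>x'\<in>\<phi> ` right_limits. x' \<noteq> x \<and> iet L \<mu> x' = iet L \<mu> x}"
      using u v(1) by blast
  qed
qed

end

section \<open>Colliding words and the final count\<close>

context generalized_thue_morse
begin

lemma minimal_aperiodic:
  assumes "invariant_prob L \<mu>"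
  shows "minimal_aperiodic_subshift L m \<mu>"
proof
  show "closed L" by (simp add: thue_morse_subshift_def)
next
  fix w v n assume "w \<in> L" "v \<in> L"
  then show "\<exists>i. agree n w ((shift ^^ i) v)" using L_recurrent by blast
qed (use assms L_less L_shift L_aperiodic in auto)

lemma collisions:
  assumes "invariant_prob L \<mu>"
  defines "E \<equiv> minimal_aperiodic_subshift.right_limits L"
  shows "{w \<in> E. \<exists>w'\<in>E. w' \<noteq> w \<and> shift w' = shift w} =
    (\<lambda>(c, b). case_nat b (thue_word m c)) ` (({..<m} - {m - 2}) \<times> {..<m})" (is "?D = ?W")
proof -
  interpret minimal_aperiodic_subshift L m \<mu>
    using assms(1) by (rule minimal_aperiodic)
  show ?thesis
  proof
    show "?D \<subseteq> ?W"
    proof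
      fix w assume "w \<in> ?D"
      then obtain w' where w: "w \<in> right_limits" "w' \<in> right_limits" "w \<noteq> w'" "shift w = shift w'"
        unfolding E_def by auto
      have wL: "w \<in> L" "w' \<in> L" using w(1,2) by (auto dest: right_limits_subset)
      have sh: "shift w = thue_word m (w 1)" using wL w(3,4) by (rule left_special)
      have "w 1 \<noteq> m - 2"
      proof
        assume eq: "w 1 = m - 2"
        obtain v where v: "v \<in> L" "agree 1 (shift w) v" "less_fun (shift w) v"
          using shift_right_limits[OF w(1)] by (auto simp: right_limits_def)
        have "v 0 = m - 2" using agreeD[OF v(2), of 0] eq by (simp add: shift_def)
        then show False using thue_word_max[OF v(1)] v(3) sh eq by simp
      qed
      moreover have "w = case_nat (w 0) (thue_word m (w 1))"
        by (rule word_eqI) (simp_all add: sh)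
      ultimately show "w \<in> ?W"
        using L_less[OF wL(1)] by (intro rev_image_eqI[of "(w 1, w 0)"]) auto
    qed
    show "?W \<subseteq> ?D"
    proof
      fix w assume "w \<in> ?W"
      then obtain b c where w: "w = case_nat b (thue_word m c)" and bc: "b < m" "c < m" "c \<noteq> m - 2"
        by auto
      have ext: "case_nat a (thue_word m c) \<in> right_limits" if "a < m" for a
        using extension_in_L[OF that bc(2)] extension_not_max[OF that bc(2,3)]
        by (simp add: right_limits_def)
      \<comment> \<open>Any letter other than \<open>b\<close> yields a collision partner;
        \<open>m \<ge> 2\<close> provides one.\<close>
      define a where "a = (if b = 0 then 1 else 0 :: nat)"
      have "a < m" "a \<noteq> b" using m by (auto simp: a_def)
      then have "case_nat a (thue_word m c) \<noteq> w"
        unfolding w by (metis nat.case(1))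
      then show "w \<in> ?D"
        unfolding E_def using ext[OF bc(1)] ext[OF \<open>a < m\<close>] w
        by (auto intro!: bexI[of _ "case_nat a (thue_word m c)"])
    qed
  qed
qed

end

theorem theorem1:
  fixes m :: nat and \<mu> :: "word measure"
  assumes "m \<ge> 2"
    and "invariant_prob (thue_morse_subshift m) \<mu>"
  shows "card (noninjectivity_points (iet (thue_morse_subshift m) \<mu>) {0..<1}) = m * (m - 1) \<and>
    (\<exists>P. partition_on (noninjectivity_points (iet (thue_morse_subshift m) \<mu>) {0..<1}) P \<and>
         card P = m - 1 \<and>
         (\<forall>B\<in>P. card B = m \<and>
            (\<forall>x\<in>B. \<forall>y\<in>B. iet (thue_morse_subshift m) \<mu> x = iet (thue_morse_subshift m) \<mu> y)))"
proof -
  interpret generalized_thue_morse m by unfold_locales fact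
  interpret minimal_aperiodic_subshift "thue_morse_subshift m" m \<mu> using assms(2) by (rule minimal_aperiodic)
  let ?N = "noninjectivity_points (iet (thue_morse_subshift m) \<mu>) {0..<1}"
  define C where "C = {..<m} - {m - 2}"
  define ext where "ext c b = case_nat b (thue_word m c)" for c b :: nat
  \<comment> \<open>The class of points whose common image is \<open>\<phi>\<close> of t^(c), one
    for each preceding letter.\<close>
  define block where "block c = (\<lambda>b. phi (thue_morse_subshift m) \<mu> (ext c b)) ` {..<m}" for c
  have card_C: "card C = m - 1" "C \<noteq> {}"
  proof -
    show "card C = m - 1" using assms(1) by (simp add: C_def)
    then show "C \<noteq> {}" using assms(1) by auto
  qed
  have D: "{w \<in> right_limits. \<exists>w'\<in>right_limits. w' \<noteq> w \<and> shift w' = shift w} =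
      (\<lambda>(c, b). ext c b) ` (C \<times> {..<m})"
    unfolding C_def ext_def by (rule collisions[OF assms(2)])
  then have ext_in: "ext c b \<in> right_limits" if "c \<in> C" "b < m" for c b
    using that by blast
  have ext_inj: "c = c' \<and> b = b'"
    if "c \<in> C" "b < m" "c' \<in> C" "b' < m" "phi (thue_morse_subshift m) \<mu> (ext c b) = phi (thue_morse_subshift m) \<mu> (ext c' b')" for c b c' b'
  proof -
    have "ext c b = ext c' b'"
      using that(5) inj_on_eq_iff[OF phi_inj_right_limits ext_in[OF that(1,2)] ext_in[OF that(3,4)]]
      by simp
    \<comment> \<open>Position 0 recovers \<open>b\<close>, and position 1 recovers \<open>c\<close>
      because t^(c) begins with \<open>c\<close>.\<close>
    then have "ext c b 0 = ext c' b' 0" "ext c b 1 = ext c' b' 1" by simp_all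
    then show ?thesis using that(1,3) by (auto simp: ext_def C_def)
  qed
  have N: "?N = (\<lambda>(c, b). phi (thue_morse_subshift m) \<mu> (ext c b)) ` (C \<times> {..<m})"
    unfolding noninjectivity_points_iet D image_image by (simp add: case_prod_unfold)
  have "inj_on (\<lambda>(c, b). phi (thue_morse_subshift m) \<mu> (ext c b)) (C \<times> {..<m})"
    unfolding inj_on_def using ext_inj by auto
  then have "card ?N = m * (m - 1)"
    unfolding N by (simp add: card_image card_cartesian_product card_C)
  moreover have "partition_on ?N (block ` C)"
  proof (rule partition_onI)
    show "\<Union> (block ` C) = ?N" unfolding N block_def by auto
    show "{} \<notin> block ` C" using assms(1) by (auto simp: block_def lessThan_empty_iff)
    show "disjnt p q" if pq: "p \<in> block ` C" "q \<in> block ` C" "p \<noteq> q" for p q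
    proof -
      obtain c c' where cc: "c \<in> C" "c' \<in> C" "p = block c" "q = block c'" using pq(1,2) by blast
      then have "c \<noteq> c'" using pq(3) by blast
      then show ?thesis
        using ext_inj[OF cc(1) _ cc(2)] unfolding cc disjnt_def block_def by auto
    qed
  qed
  moreover have "card (block ` C) = m - 1"
  proof -
    have "inj_on block C"
    proof (rule inj_onI)
      fix c c' assume c: "c \<in> C" "c' \<in> C" "block c = block c'"
      have "phi (thue_morse_subshift m) \<mu> (ext c 0) \<in> block c"
        unfolding block_def using assms(1) by (intro imageI) simp
      then obtain b where "b < m"
        "phi (thue_morse_subshift m) \<mu> (ext c 0) = phi (thue_morse_subshift m) \<mu> (ext c' b)"
        unfolding c(3) by (auto simp: block_def)
      then show "c = c'" using ext_inj[OF c(1) _ c(2)] assms(1) by auto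
    qed
    then show ?thesis by (simp add: card_image card_C)
  qed
  moreover have "card B = m \<and> (\<forall>x\<in>B. \<forall>y\<in>B. iet (thue_morse_subshift m) \<mu> x = iet (thue_morse_subshift m) \<mu> y)" if B: "B \<in> block ` C" for B
  proof -
    obtain c where c: "c \<in> C" "B = block c" using B by blast
    have "inj_on (\<lambda>b. phi (thue_morse_subshift m) \<mu> (ext c b)) {..<m}"
      unfolding inj_on_def using ext_inj[OF c(1) _ c(1)] by blast
    then have "card B = m" unfolding c(2) block_def by (simp add: card_image)
    moreover have "iet (thue_morse_subshift m) \<mu> x = phi (thue_morse_subshift m) \<mu> (thue_word m c)" if "x \<in> B" for x
      using that c ext_in[OF c(1)] by (auto simp: block_def iet_phi ext_def)
    ultimately show ?thesis by simp
  qed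
  ultimately show ?thesis by blast
qed

end
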